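(* Let $K$ be an infinite field of characteristic $2$. Every multilinear polynomial identity of $M_2(K)$ of degree up to $7$ is a consequence of the following three identities: $$\mathrm{st}_4(x_1,x_2,x_3,x_4)=\sum_{\sigma\in\mathcal{S}_4}\operatorname{sign}(\sigma)\,x_{\sigma(1)}x_{\sigma(2)}x_{\sigma(3)}x_{\sigma(4)},$$ $$\mathfrak{S}(x_1,x_2,x_3,x_4,x_5)=[[x_1,x_2][x_3,x_5],x_4]+[[x_1,x_3][x_4,x_5],x_2]+[[x_1,x_4][x_2,x_5],x_3],$$ $$\mathfrak{T}(x_1,x_2,x_3,x_4,x_5)=[[x_1,x_2],x_3][x_4,x_5]+[[x_1,x_2],x_4][x_5,x_3]+[[x_1,x_2],x_5][x_3,x_4].$$ Moreover, none of these three identities can be omitted: for each of the three, it is not true that every multilinear polynomial identity of $M_2(K)$ of degree up to $7$ is a consequence of the other two.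
   Context: All algebras are associative over $K$. $M_2(K)$ is the algebra of $2\times 2$ matrices over $K$; $K\langle X\rangle$ is the free associative algebra on $X=\{x_1,x_2,\ldots\}$; $[u,v]=uv-vu$; $\mathcal{S}_4$ is the symmetric group on $\{1,2,3,4\}$. A polynomial $f(x_1,\ldots,x_n)\in K\langle X\rangle$ is a polynomial identity of an algebra $\mathcal{A}$ if $f(a_1,\ldots,a_n)=0$ for all $a_1,\ldots,a_n\in\mathcal{A}$. A multilinear polynomial of degree $n$ is (up to the choice of the variable set) a linear combination of the monomials $x_{\sigma(1)}\cdots x_{\sigma(n)}$ with $\sigma$ a permutation of $\{1,\ldots,n\}$. A T-ideal of $K\langle X\rangle$ is a two-sided ideal $I$ with $\phi(I)\subseteq I$ for every endomorphism $\phi$ of $K\langle X\rangle$; $\langle f_1,\ldots,f_k\rangle^{\mathrm{T}}$ is the smallest T-ideal containing $f_1,\ldots,f_k$. A polynomial $f$ is a consequence of $f_1,\ldots,f_k$ if $f\in\langle f_1,\ldots,f_k\rangle^{\mathrm{T}}$. *)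

theory Defs
  imports
    "HOL-Analysis.Analysis"
    "HOL-Combinatorics.Multiset_Permutations"
    "HOL-Library.Poly_Mapping"
begin

text \<open>
  Words form the free monoid under concatenation, written additively, because the convolution
  product of \<^typ>\<open>'a \<Rightarrow>\<^sub>0 'b\<close> requires \<^class>\<open>monoid_add\<close> on the exponents. Hence
  the monoid ring \<^typ>\<open>nat list \<Rightarrow>\<^sub>0 'k\<close> is the free associative unital algebra over
  \<open>'k\<close> on countably many variables. \<open>HOL-Library.ListVector\<close> has a
  different (pointwise) addition on lists and must not be imported alongside.
\<close>

instantiation list :: (type) monoid_add
begin

definition zero_list :: "'a list" where "0 = []"

definition plus_list :: "'a list \<Rightarrow> 'a list \<Rightarrow> 'a list" where "xs + ys = xs @ ys"

instance
  by intro_classes (simp_all add: zero_list_def plus_list_def)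

end

type_synonym 'k free_algebra = "nat list \<Rightarrow>\<^sub>0 'k"

definition X :: "nat \<Rightarrow> 'k::field free_algebra" where
  "X i = Poly_Mapping.single [i] 1"

definition multilinear :: "nat \<Rightarrow> 'k::field free_algebra \<Rightarrow> bool" where
  "multilinear n f \<longleftrightarrow>
     (\<exists>V. finite V \<and> card V = n \<and> Poly_Mapping.keys f \<subseteq> permutations_of_set V)"

text \<open>
  Matrices are multiplied with \<open>**\<close>; the class operation \<open>*\<close> on
  \<^typ>\<open>'k ^ 'n ^ 'n\<close> is the entrywise product. The factor \<open>mat c\<close> is the scalar matrix.
\<close>

definition eval_matrix :: "(nat \<Rightarrow> 'k ^ 'n ^ 'n) \<Rightarrow> 'k::field free_algebra \<Rightarrow> 'k ^ 'n ^ 'n" where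
  "eval_matrix a f =
     (\<Sum>w\<in>Poly_Mapping.keys f.
        mat (Poly_Mapping.lookup f w) ** foldr (\<lambda>i M. a i ** M) w (mat 1))"

definition identity_of_M2 :: "'k::field free_algebra \<Rightarrow> bool" where
  "identity_of_M2 f \<longleftrightarrow> (\<forall>a :: nat \<Rightarrow> 'k ^ 2 ^ 2. eval_matrix a f = 0)"

definition algebra_endomorphism :: "('k::field free_algebra \<Rightarrow> 'k free_algebra) \<Rightarrow> bool" where
  "algebra_endomorphism \<phi> \<longleftrightarrow>
     (\<forall>f g. \<phi> (f + g) = \<phi> f + \<phi> g) \<and>
     (\<forall>f g. \<phi> (f * g) = \<phi> f * \<phi> g) \<and>
     (\<forall>c f. \<phi> (Poly_Mapping.map ((*) c) f) = Poly_Mapping.map ((*) c) (\<phi> f)) \<and>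
     \<phi> 1 = 1"

definition two_sided_ideal :: "'k::field free_algebra set \<Rightarrow> bool" where
  "two_sided_ideal I \<longleftrightarrow>
     0 \<in> I \<and> (\<forall>f\<in>I. \<forall>g\<in>I. f + g \<in> I) \<and> (\<forall>f\<in>I. \<forall>g. g * f \<in> I \<and> f * g \<in> I)"

definition T_ideal :: "'k::field free_algebra set \<Rightarrow> bool" where
  "T_ideal I \<longleftrightarrow> two_sided_ideal I \<and> (\<forall>\<phi>. algebra_endomorphism \<phi> \<longrightarrow> \<phi> ` I \<subseteq> I)"

definition consequence :: "'k::field free_algebra \<Rightarrow> 'k free_algebra set \<Rightarrow> bool" where
  "consequence f F \<longleftrightarrow> f \<in> T_ideal hull F"

definition commutator :: "'a::ring \<Rightarrow> 'a \<Rightarrow> 'a" where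
  "commutator u v = u * v - v * u"

definition st4 :: "'k::field free_algebra" where
  "st4 = (\<Sum>\<sigma> | \<sigma> permutes {1..4}. of_int (sign \<sigma>) * (X (\<sigma> 1) * X (\<sigma> 2) * X (\<sigma> 3) * X (\<sigma> 4)))"

definition S5 :: "'k::field free_algebra" where
  "S5 =
     commutator (commutator (X 1) (X 2) * commutator (X 3) (X 5)) (X 4) +
     commutator (commutator (X 1) (X 3) * commutator (X 4) (X 5)) (X 2) +
     commutator (commutator (X 1) (X 4) * commutator (X 2) (X 5)) (X 3)"

definition T5 :: "'k::field free_algebra" where
  "T5 =
     commutator (commutator (X 1) (X 2)) (X 3) * commutator (X 4) (X 5) +
     commutator (commutator (X 1) (X 2)) (X 4) * commutator (X 5) (X 3) +
     commutator (commutator (X 1) (X 2)) (X 5) * commutator (X 3) (X 4)"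

definition multilinear_identities_upto_7_follow_from :: "'k::field free_algebra set \<Rightarrow> bool" where
  "multilinear_identities_upto_7_follow_from F \<longleftrightarrow>
     (\<forall>n\<le>7. \<forall>f. multilinear n f \<longrightarrow> identity_of_M2 f \<longrightarrow> consequence f F)"

end

theory Submission
  imports Defs "HOL-Library.Sublist"
begin

text \<open>
  Work in characteristic 2 modulo the T-ideal \<open>I\<close> generated by the three identities, and order
  words of equal length lexicographically.

  \<^bold>\<open>Spanning.\<close> The element of \<open>I\<close> obtained from a multilinear one by substituting words
  \<open>Y\<^sub>i\<close> for the variables and multiplying by words has as its leading (largest) word the
  corresponding substitution instance of the leading word, provided that the first letters of the
  \<open>Y\<^sub>i\<close> are in the same order as the indices \<open>i\<close>. Hence the leading words of \<open>I\<close> among words without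
  repeated letters are closed under containment of patterns in the sense of permutation patterns.
  Sums of at most eight instances of the three identities yield twenty-three patterns, of
  lengths 4 to 7. Words that avoid all of them (\<^emph>\<open>normal\<close> words) span the multilinear elements
  modulo \<open>I\<close>. A normal word \<open>w\<close> may be replaced by an element with the same leading word: cut \<open>w\<close>
  before each left-to-right maximum, replace each of the resulting blocks by the left-normed
  commutator of its letters, and multiply. This holds in every degree
  (\<open>words_spanned_by_block_products\<close>).

  \<^bold>\<open>Independence.\<close> For at most seven variables the block products of normal words are
  linearly independent as functions on \<open>2 \<times> 2\<close> matrices (\<open>normal_words_independent\<close>). Substituting
  1 for a variable annihilates every block product in which the variable lies in a block of length
  at least 2, and erases it where it is a block of its own. So one may assume
  that no block is a single letter. There are 1, 0, 1, 2, 8, 19, 50, 125 such normal words of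
  length 0, ..., 7, and for each length they can be ordered so that their values at suitable matrix
  units form a triangular matrix with unit diagonal. A multilinear identity of degree at most 7
  is therefore congruent modulo \<open>I\<close> to a combination of block products all of whose
  coefficients vanish.

  \<^bold>\<open>Irredundancy.\<close> For each of the three identities there is a short list of words such that the
  sum of the coefficients at these words is nonzero for that identity, but vanishes on all
  consequences of the other two (\<open>word_sum_in_annihilated\<close>, \<open>not_consequence\<close>).
\<close>

section \<open>The free algebra and its substitutions\<close>

text \<open>
  The monomial of a word, and the embedding of the field as the scalars.
\<close>

definition mon :: "nat list \<Rightarrow> 'k::field free_algebra" where
  "mon w = Poly_Mapping.single w 1"

definition scal :: "'k::field \<Rightarrow> 'k free_algebra" where
  "scal c = Poly_Mapping.single [] c"

lemma mon_append: "mon (u @ v) = mon u * mon v"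
  by (simp add: mon_def mult_single plus_list_def)

lemma mon_Nil: "mon [] = 1"
  using single_one[where 'a="nat list"] by (simp add: mon_def zero_list_def)

lemma mon_eq_prod_X: "(mon w :: 'k::field free_algebra) = prod_list (map X w)"
proof (induction w)
  case (Cons i w)
  have "(mon (i # w) :: 'k free_algebra) = mon [i] * mon w" using mon_append[of "[i]" w] by simp
  also have "mon [i] = (X i :: 'k free_algebra)" by (simp add: mon_def X_def)
  finally show ?case by (simp add: Cons.IH)
qed (simp add: mon_Nil)

lemma scal_times_mon: "scal c * mon w = Poly_Mapping.single w c"
  by (simp add: mon_def scal_def mult_single plus_list_def)

lemma mon_times_scal: "mon w * scal c = Poly_Mapping.single w c"
  by (simp add: mon_def scal_def mult_single plus_list_def)

lemma scal_0: "scal 0 = 0" by (simp add: scal_def)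
lemma scal_1: "scal 1 = 1" using mon_Nil by (simp add: scal_def mon_def)
lemma scal_add: "scal (a + b) = scal a + scal b" by (simp add: scal_def single_add)
lemma scal_mult: "scal (a * b) = scal a * scal b" by (simp add: scal_def mult_single plus_list_def)

lemma free_algebra_expand:
  "f = (\<Sum>w\<in>Poly_Mapping.keys f. scal (Poly_Mapping.lookup f w) * mon w)"
proof (rule poly_mapping_eqI)
  fix v
  have "Poly_Mapping.lookup (\<Sum>w\<in>Poly_Mapping.keys f. scal (Poly_Mapping.lookup f w) * mon w) v =
      (\<Sum>w\<in>Poly_Mapping.keys f. if w = v then Poly_Mapping.lookup f w else 0)"
    by (simp add: scal_times_mon lookup_sum lookup_single when_def)
  then show "Poly_Mapping.lookup f v =
      Poly_Mapping.lookup (\<Sum>w\<in>Poly_Mapping.keys f. scal (Poly_Mapping.lookup f w) * mon w) v"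
    by (simp add: in_keys_iff)
qed

lemma free_algebra_induct [case_names monomial add]:
  assumes monomial: "\<And>c w. P (scal c * mon w)" and add: "\<And>f g. P f \<Longrightarrow> P g \<Longrightarrow> P (f + g)"
  shows "P f"
proof -
  have "P 0" using monomial[of 0 "[]"] by (simp add: scal_0)
  have "P (\<Sum>w\<in>W. scal (Poly_Mapping.lookup f w) * mon w)" if "finite W" for W
    using that by (induction) (auto simp: \<open>P 0\<close> intro: monomial add)
  then show ?thesis by (subst free_algebra_expand) simp
qed

lemma scal_commute: "scal c * f = f * scal c"
proof (induction f rule: free_algebra_induct)
  case (monomial d w)
  have "scal c * (scal d * mon w) = scal (c * d) * mon w" by (simp add: scal_mult mult.assoc)
  also have "\<dots> = scal d * (scal c * mon w)" by (simp add: scal_mult flip: mult.assoc mult.commute[of d c])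
  also have "\<dots> = scal d * (mon w * scal c)" by (simp only: scal_times_mon mon_times_scal)
  finally show ?case by (simp add: mult.assoc)
qed (simp add: algebra_simps)

text \<open>
  Evaluation of a free algebra element at an assignment \<open>y\<close> of the variables in a
  unital ring that is an algebra by means of a ring homomorphism \<open>h\<close> from the field to
  the centre of the ring.
\<close>

locale central_hom =
  fixes h :: "'k::field \<Rightarrow> 'b::ring_1"
  assumes h_0: "h 0 = 0" and h_1: "h 1 = 1"
    and h_add: "h (c + d) = h c + h d" and h_mult: "h (c * d) = h c * h d"
    and h_central: "h c * x = x * h c"
begin

definition evalp :: "(nat \<Rightarrow> 'b) \<Rightarrow> 'k free_algebra \<Rightarrow> 'b" where
  "evalp y f = (\<Sum>w\<in>Poly_Mapping.keys f. h (Poly_Mapping.lookup f w) * prod_list (map y w))"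

lemma evalp_add: "evalp y (f + g) = evalp y f + evalp y g"
  unfolding evalp_def by (rule setsum_keys_plus_distrib) (simp_all add: h_0 h_add distrib_right)

lemma evalp_0: "evalp y 0 = 0"
  by (simp add: evalp_def)

lemma evalp_uminus: "evalp y (- f) = - evalp y f"
  using evalp_add[of y f "- f"] by (simp add: evalp_0 eq_neg_iff_add_eq_0 add.commute)

lemma evalp_diff: "evalp y (f - g) = evalp y f - evalp y g"
  using evalp_add[of y f "- g"] by (simp add: evalp_uminus)

lemma evalp_sum: "evalp y (sum F A) = (\<Sum>a\<in>A. evalp y (F a))"
  by (induction A rule: infinite_finite_induct) (simp_all add: evalp_add evalp_0)

lemma evalp_single: "evalp y (Poly_Mapping.single w c) = h c * prod_list (map y w)"
  by (simp add: evalp_def h_0)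

lemma evalp_mult: "evalp y (f * g) = evalp y f * evalp y g"
proof (induction f rule: free_algebra_induct)
  case (monomial c u)
  show ?case
  proof (induction g rule: free_algebra_induct)
    case (monomial d v)
    have "evalp y (scal c * mon u * (scal d * mon v)) = h (c * d) * prod_list (map y (u @ v))"
      by (simp add: scal_times_mon mult_single plus_list_def evalp_single)
    also have "\<dots> = h c * (h d * prod_list (map y u)) * prod_list (map y v)"
      by (simp add: h_mult mult.assoc)
    also have "\<dots> = h c * prod_list (map y u) * (h d * prod_list (map y v))"
      by (subst h_central) (simp add: mult.assoc)
    finally show ?case by (simp add: scal_times_mon evalp_single)
  qed (simp add: evalp_add distrib_left)
qed (simp add: evalp_add distrib_right)

lemma evalp_mon: "evalp y (mon w) = prod_list (map y w)"
  by (simp add: mon_def evalp_single h_1)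

lemma evalp_X: "evalp y (X i) = y i"
  by (simp add: X_def evalp_single h_1)

lemma evalp_1: "evalp y 1 = 1"
  using evalp_mon[of y "[]"] by (simp add: mon_Nil)

lemma evalp_scal: "evalp y (scal c) = h c"
  by (simp add: scal_def evalp_single)

lemma evalp_prod_list: "evalp y (prod_list fs) = prod_list (map (evalp y) fs)"
  by (induction fs) (simp_all add: evalp_1 evalp_mult)

lemma evalp_sum_list: "evalp y (sum_list fs) = sum_list (map (evalp y) fs)"
  by (induction fs) (simp_all add: evalp_0 evalp_add)

end

interpretation free: central_hom scal
  by unfold_locales (rule scal_0 scal_1 scal_add scal_mult scal_commute)+

lemma map_times_eq: "Poly_Mapping.map ((*) c) f = scal c * f"
  by (simp add: mult_map_scale_conv_mult scal_def zero_list_def)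

lemma algebra_endomorphism_evalp: "algebra_endomorphism (free.evalp y)"
  by (simp add: algebra_endomorphism_def map_times_eq free.evalp_add free.evalp_mult
      free.evalp_1 free.evalp_scal)

lemma algebra_endomorphism_scal:
  assumes "algebra_endomorphism \<phi>" shows "\<phi> (scal c) = scal c"
  using assms unfolding algebra_endomorphism_def map_times_eq by (metis mult.right_neutral)

lemma algebra_endomorphism_mon:
  assumes "algebra_endomorphism \<phi>" shows "\<phi> (mon w) = prod_list (map (\<lambda>i. \<phi> (X i)) w)"
  using assms unfolding mon_eq_prod_X algebra_endomorphism_def by (induction w) simp_all

lemma algebra_endomorphism_comp:
  "algebra_endomorphism \<phi> \<Longrightarrow> algebra_endomorphism \<psi> \<Longrightarrow> algebra_endomorphism (\<lambda>f. \<phi> (\<psi> f))"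
  by (simp add: algebra_endomorphism_def)

lemma (in central_hom) evalp_endomorphism:
  assumes "algebra_endomorphism \<phi>"
  shows "evalp y (\<phi> f) = evalp (\<lambda>i. evalp y (\<phi> (X i))) f"
proof (induction f rule: free_algebra_induct)
  case (monomial c w)
  have "\<phi> (scal c * mon w) = scal c * prod_list (map (\<lambda>i. \<phi> (X i)) w)"
    using assms by (simp add: algebra_endomorphism_def algebra_endomorphism_scal[OF assms]
        algebra_endomorphism_mon[OF assms])
  then show ?case
    by (simp add: evalp_mult evalp_scal evalp_mon evalp_prod_list comp_def)
next
  case (add f g)
  then show ?case using assms by (simp add: algebra_endomorphism_def evalp_add)
qed

section \<open>T-ideals\<close>

lemma (in central_hom) T_ideal_identities: "T_ideal {f. \<forall>y. evalp y f = 0}"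
proof -
  have "evalp y (\<phi> f) = 0" if "algebra_endomorphism \<phi>" "\<forall>y. evalp y f = 0" for y \<phi> f
    by (subst evalp_endomorphism[OF that(1)]) (simp add: that(2))
  then show ?thesis
    by (auto simp: T_ideal_def two_sided_ideal_def evalp_0 evalp_add evalp_mult)
qed

lemma T_ideal_hull: "T_ideal (T_ideal hull F)"
proof (rule hull_in)
  fix \<F> :: "'a free_algebra set set"
  assume *: "Ball \<F> T_ideal"
  have "two_sided_ideal (\<Inter>\<F>)"
    using * unfolding T_ideal_def two_sided_ideal_def by simp
  moreover have "\<phi> ` \<Inter>\<F> \<subseteq> \<Inter>\<F>" if "algebra_endomorphism \<phi>" for \<phi>
    using * that unfolding T_ideal_def by (meson Inter_greatest Inter_lower image_mono subset_trans)
  ultimately show "T_ideal (\<Inter>\<F>)"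
    by (simp add: T_ideal_def)
qed

context
  fixes I :: "'k::field free_algebra set"
  assumes I: "T_ideal I"
begin

lemma T_ideal_0: "0 \<in> I"
  using I by (simp add: T_ideal_def two_sided_ideal_def)

lemma T_ideal_add: "f \<in> I \<Longrightarrow> g \<in> I \<Longrightarrow> f + g \<in> I"
  using I by (simp add: T_ideal_def two_sided_ideal_def)

lemma T_ideal_mult_left: "f \<in> I \<Longrightarrow> g * f \<in> I"
  using I by (simp add: T_ideal_def two_sided_ideal_def)

lemma T_ideal_mult_right: "f \<in> I \<Longrightarrow> f * g \<in> I"
  using I by (simp add: T_ideal_def two_sided_ideal_def)

lemma T_ideal_evalp: "f \<in> I \<Longrightarrow> free.evalp y f \<in> I"
  using I algebra_endomorphism_evalp[of y] unfolding T_ideal_def by blast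

end

section \<open>Multilinear polynomials with coefficients 0 and 1\<close>

text \<open>
  The value at \<open>y\<close> of the sum of the words in \<open>Q\<close>. Over a ring of characteristic 2 every multilinear
  polynomial with coefficients in the prime field has this form; a word that occurs twice
  in \<open>Q\<close> cancels.
\<close>

definition word_sum :: "nat list list \<Rightarrow> (nat \<Rightarrow> 'b::ring_1) \<Rightarrow> 'b" where
  "word_sum Q y = (\<Sum>q\<leftarrow>Q. prod_list (map y q))"

text \<open>
  The words occurring in the three identities, with odd coefficient. Of the twenty-four words that
  arise on expanding \<^const>\<open>S5\<close>, three pairs of equal words cancel.
\<close>

definition st4_words :: "nat list list" where
  "st4_words =
    [[1,2,3,4], [1,2,4,3], [1,3,2,4], [1,3,4,2], [1,4,2,3], [1,4,3,2],
     [2,1,3,4], [2,1,4,3], [2,3,1,4], [2,3,4,1], [2,4,1,3], [2,4,3,1],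
     [3,1,2,4], [3,1,4,2], [3,2,1,4], [3,2,4,1], [3,4,1,2], [3,4,2,1],
     [4,1,2,3], [4,1,3,2], [4,2,1,3], [4,2,3,1], [4,3,1,2], [4,3,2,1]]"

definition S5_words :: "nat list list" where
  "S5_words = [
     [1,2,3,5,4], [1,2,5,3,4], [1,3,4,5,2], [1,3,5,4,2], [1,4,2,5,3], [1,4,5,2,3],
     [2,1,3,4,5], [2,1,5,3,4], [2,3,1,4,5], [2,3,1,5,4], [3,1,4,2,5], [3,1,5,4,2],
     [3,4,1,2,5], [3,4,1,5,2], [4,1,2,3,5], [4,1,5,2,3], [4,2,1,3,5], [4,2,1,5,3]]"

definition T5_words :: "nat list list" where
  "T5_words = [
     [1,2,3,4,5], [1,2,3,5,4], [1,2,4,3,5], [1,2,4,5,3], [1,2,5,3,4], [1,2,5,4,3],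
     [2,1,3,4,5], [2,1,3,5,4], [2,1,4,3,5], [2,1,4,5,3], [2,1,5,3,4], [2,1,5,4,3],
     [3,1,2,4,5], [3,1,2,5,4], [3,2,1,4,5], [3,2,1,5,4], [4,1,2,3,5], [4,1,2,5,3],
     [4,2,1,3,5], [4,2,1,5,3], [5,1,2,3,4], [5,1,2,4,3], [5,2,1,3,4], [5,2,1,4,3]]"

context
  fixes y :: "nat \<Rightarrow> 'b::ring_1"
  assumes double: "\<And>x :: 'b. x + x = 0"
begin

lemma double_left: "x + (x + z) = (z :: 'b)"
  by (simp add: double flip: add.assoc)

lemma minus_char_2: "x - z = x + (z :: 'b)"
  by (metis double_left diff_add_cancel add.commute)

lemma word_sum_st4: "word_sum st4_words y =
    commutator (commutator (y 1) (y 2)) (commutator (y 3) (y 4)) +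
    commutator (commutator (y 1) (y 3)) (commutator (y 2) (y 4)) +
    commutator (commutator (y 1) (y 4)) (commutator (y 2) (y 3))"
  unfolding word_sum_def st4_words_def commutator_def
  by (simp add: minus_char_2 distrib_left distrib_right mult.assoc add_ac double double_left)

lemma word_sum_S5: "word_sum S5_words y =
    commutator (commutator (y 1) (y 2) * commutator (y 3) (y 5)) (y 4) +
    commutator (commutator (y 1) (y 3) * commutator (y 4) (y 5)) (y 2) +
    commutator (commutator (y 1) (y 4) * commutator (y 2) (y 5)) (y 3)"
  unfolding word_sum_def S5_words_def commutator_def
  by (simp add: minus_char_2 distrib_left distrib_right mult.assoc add_ac double double_left)

lemma word_sum_T5: "word_sum T5_words y =
    commutator (commutator (y 1) (y 2)) (y 3) * commutator (y 4) (y 5) +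
    commutator (commutator (y 1) (y 2)) (y 4) * commutator (y 5) (y 3) +
    commutator (commutator (y 1) (y 2)) (y 5) * commutator (y 3) (y 4)"
  unfolding word_sum_def T5_words_def commutator_def
  by (simp add: minus_char_2 distrib_left distrib_right mult.assoc add_ac double double_left)

end

lemma two_eq_0_if_CHAR_2:
  assumes "CHAR('k::field) = 2" shows "(2 :: 'k) = 0"
  using of_nat_CHAR[where 'a='k] assms by simp

lemma double_eq_0_if_CHAR_2:
  assumes "CHAR('k::field) = 2" shows "(c :: 'k) + c = 0"
  using two_eq_0_if_CHAR_2[OF assms] by (metis mult_2 mult_zero_left)

lemma free_algebra_double:
  assumes "CHAR('k::field) = 2" shows "(f :: 'k free_algebra) + f = 0"
  by (rule poly_mapping_eqI) (simp add: lookup_add double_eq_0_if_CHAR_2[OF assms])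

lemma st4_eq_word_sum:
  assumes "CHAR('k::field) = 2" shows "(st4 :: 'k free_algebra) = word_sum st4_words X"
proof -
  have sgn: "of_int (sign \<sigma>) = (1 :: 'k free_algebra)" for \<sigma> :: "nat \<Rightarrow> nat"
    using minus_unique[OF free_algebra_double[OF assms, of 1]] by (simp add: sign_def)
  define F :: "(nat \<Rightarrow> nat) \<Rightarrow> 'k free_algebra" where "F \<sigma> = X (\<sigma> 1) * X (\<sigma> 2) * X (\<sigma> 3) * X (\<sigma> 4)" for \<sigma>
  have range: "{1..4::nat} = insert 1 (insert 2 (insert 3 (insert 4 {})))" by auto
  have "st4 = (\<Sum>\<sigma> | \<sigma> permutes insert 1 (insert 2 (insert 3 (insert 4 {}))). F \<sigma>)"
    unfolding st4_def F_def sgn range by simp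
  also have "\<dots> = word_sum st4_words X"
    by (simp add: sum_over_permutations_insert permutes_empty)
      (simp add: F_def transpose_def word_sum_def st4_words_def mult.assoc add_ac)
  finally show ?thesis .
qed

lemma S5_eq_word_sum:
  assumes "CHAR('k::field) = 2" shows "(S5 :: 'k free_algebra) = word_sum S5_words X"
  unfolding S5_def using word_sum_S5[OF free_algebra_double[OF assms], of X] by simp

lemma T5_eq_word_sum:
  assumes "CHAR('k::field) = 2" shows "(T5 :: 'k free_algebra) = word_sum T5_words X"
  unfolding T5_def using word_sum_T5[OF free_algebra_double[OF assms], of X] by simp

lemma (in central_hom) evalp_word_sum: "evalp y (word_sum Q X) = word_sum Q y"
  by (simp add: word_sum_def evalp_sum_list evalp_prod_list evalp_X comp_def)

lemma T_ideal_word_sum: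
  assumes "T_ideal I" and "word_sum Q X \<in> I" shows "word_sum Q y \<in> I"
  using T_ideal_evalp[OF assms] by (simp add: free.evalp_word_sum)

section \<open>Two by two matrices as a ring\<close>

text \<open>
  The entrywise product is the class multiplication on \<^typ>\<open>'k ^ 2 ^ 2\<close>; a type of its own gives
  the matrix algebra as an instance of \<^class>\<open>ring_1\<close>.
\<close>

datatype 'a m2 = M2 (m11: 'a) (m12: 'a) (m21: 'a) (m22: 'a)

instantiation m2 :: (comm_ring_1) ring_1
begin
definition "0 = M2 0 0 0 0"
definition "1 = M2 1 0 0 1"
definition "A + B = M2 (m11 A + m11 B) (m12 A + m12 B) (m21 A + m21 B) (m22 A + m22 B)"
definition "A - B = M2 (m11 A - m11 B) (m12 A - m12 B) (m21 A - m21 B) (m22 A - m22 B)"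
definition "- A = M2 (- m11 A) (- m12 A) (- m21 A) (- m22 A)"
definition "A * B = M2 (m11 A * m11 B + m12 A * m21 B) (m11 A * m12 B + m12 A * m22 B)
  (m21 A * m11 B + m22 A * m21 B) (m21 A * m12 B + m22 A * m22 B)"
instance
  by intro_classes (simp_all add: zero_m2_def one_m2_def plus_m2_def minus_m2_def uminus_m2_def
    times_m2_def algebra_simps)
end

interpretation mat2: central_hom "\<lambda>c :: 'k::field. M2 c 0 0 c"
  by unfold_locales (simp_all add: zero_m2_def one_m2_def plus_m2_def times_m2_def mult.commute)

definition to_m2 :: "'k ^ 2 ^ 2 \<Rightarrow> 'k m2" where
  "to_m2 A = M2 (A $ 1 $ 1) (A $ 1 $ 2) (A $ 2 $ 1) (A $ 2 $ 2)"

definition of_m2 :: "'k m2 \<Rightarrow> 'k ^ 2 ^ 2" where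
  "of_m2 B = (\<chi> i j. if i = 1 then if j = 1 then m11 B else m12 B else if j = 1 then m21 B else m22 B)"

lemma to_m2_of_m2 [simp]: "to_m2 (of_m2 B) = B"
  by (simp add: to_m2_def of_m2_def)

lemma to_m2_eq_0_iff: "to_m2 A = 0 \<longleftrightarrow> A = (0 :: 'k::field ^ 2 ^ 2)"
  by (auto simp: to_m2_def zero_m2_def vec_eq_iff forall_2)

lemma to_m2_add: "to_m2 (A + B) = to_m2 A + to_m2 (B :: 'k::field ^ 2 ^ 2)"
  by (simp add: to_m2_def plus_m2_def)

lemma to_m2_mult: "to_m2 (A ** B) = to_m2 A * to_m2 (B :: 'k::field ^ 2 ^ 2)"
  by (simp add: to_m2_def times_m2_def matrix_matrix_mult_def sum_2)

lemma to_m2_mat: "to_m2 (mat c) = M2 c 0 0 (c :: 'k::field)"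
  by (simp add: to_m2_def mat_def)

lemma to_m2_eval_matrix: "to_m2 (eval_matrix a f) = mat2.evalp (\<lambda>i. to_m2 (a i)) (f :: 'k::field free_algebra)"
proof -
  have fold: "to_m2 (foldr (\<lambda>i M. a i ** M) w (mat 1)) = prod_list (map (\<lambda>i. to_m2 (a i)) w)" for w
    by (induction w) (simp_all add: to_m2_mat to_m2_mult one_m2_def)
  have sum: "to_m2 (sum F W) = (\<Sum>w\<in>W. to_m2 (F w :: 'k ^ 2 ^ 2))" if "finite W" for F and W :: "nat list set"
    using that by induction (simp_all add: to_m2_add to_m2_eq_0_iff)
  show ?thesis
    by (simp add: eval_matrix_def mat2.evalp_def sum to_m2_mult to_m2_mat fold)
qed

lemma identity_of_M2_iff: "identity_of_M2 f \<longleftrightarrow> (\<forall>y. mat2.evalp y f = 0)" for f :: "'k::field free_algebra"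
proof
  assume f: "identity_of_M2 f"
  show "\<forall>y. mat2.evalp y f = 0"
  proof
    fix y :: "nat \<Rightarrow> 'k m2"
    have "to_m2 (eval_matrix (\<lambda>i. of_m2 (y i)) f) = 0"
      using f by (simp add: identity_of_M2_def to_m2_eq_0_iff)
    then show "mat2.evalp y f = 0" by (simp add: to_m2_eval_matrix)
  qed
next
  assume "\<forall>y. mat2.evalp y f = 0"
  then show "identity_of_M2 f"
    by (simp add: identity_of_M2_def to_m2_eval_matrix flip: to_m2_eq_0_iff)
qed

lemma T_ideal_identity_of_M2: "T_ideal {f :: 'k::field free_algebra. identity_of_M2 f}"
  unfolding identity_of_M2_iff by (rule mat2.T_ideal_identities)

lemma m2_double:
  assumes "CHAR('k::field) = 2" shows "(A :: 'k m2) + A = 0"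
  by (simp add: plus_m2_def zero_m2_def double_eq_0_if_CHAR_2[OF assms])

context
  assumes char: "CHAR('k::field) = 2"
begin

text \<open>
  In characteristic 2 a commutator has equal diagonal entries.
\<close>

lemma commutator_m2: "commutator (M2 a b c d :: 'k m2) (M2 a' b' c' d') =
    M2 (b * c' + b' * c) ((a + d) * b' + (a' + d') * b) ((a + d) * c' + (a' + d') * c) (b * c' + b' * c)"
  unfolding commutator_def minus_char_2[OF m2_double[OF char]] times_m2_def plus_m2_def
  by (simp add: algebra_simps two_eq_0_if_CHAR_2[OF char])

lemma commutator_commutator_m2: "commutator (M2 r p q r :: 'k m2) (M2 r' p' q' r') =
    M2 (p * q' + p' * q) 0 0 (p * q' + p' * q)"
  by (simp add: commutator_m2 two_eq_0_if_CHAR_2[OF char])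

lemmas char_2_simps = algebra_simps double_eq_0_if_CHAR_2[OF char] double_left[OF double_eq_0_if_CHAR_2[OF char]]

lemma identity_of_M2_st4: "identity_of_M2 (st4 :: 'k free_algebra)"
proof -
  have "word_sum st4_words y = 0" for y :: "nat \<Rightarrow> 'k m2"
    unfolding word_sum_st4[OF m2_double[OF char]]
    by (cases "y 1"; cases "y 2"; cases "y 3"; cases "y 4")
      (simp add: commutator_m2 commutator_commutator_m2 plus_m2_def zero_m2_def char_2_simps)
  then show ?thesis
    by (simp add: identity_of_M2_iff st4_eq_word_sum[OF char] mat2.evalp_word_sum)
qed

lemma identity_of_M2_S5: "identity_of_M2 (S5 :: 'k free_algebra)"
proof -
  have "word_sum S5_words y = 0" for y :: "nat \<Rightarrow> 'k m2"
    unfolding word_sum_S5[OF m2_double[OF char]]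
    by (cases "y 1"; cases "y 2"; cases "y 3"; cases "y 4"; cases "y 5")
      (simp add: commutator_m2 times_m2_def plus_m2_def zero_m2_def char_2_simps)
  then show ?thesis
    by (simp add: identity_of_M2_iff S5_eq_word_sum[OF char] mat2.evalp_word_sum)
qed

lemma identity_of_M2_T5: "identity_of_M2 (T5 :: 'k free_algebra)"
proof -
  have "word_sum T5_words y = 0" for y :: "nat \<Rightarrow> 'k m2"
    unfolding word_sum_T5[OF m2_double[OF char]]
    by (cases "y 1"; cases "y 2"; cases "y 3"; cases "y 4"; cases "y 5")
      (simp add: commutator_m2 times_m2_def plus_m2_def zero_m2_def char_2_simps)
  then show ?thesis
    by (simp add: identity_of_M2_iff T5_eq_word_sum[OF char] mat2.evalp_word_sum)
qed

end

section \<open>Factorisation of words at the left-to-right maxima\<close>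

text \<open>
  The factorisation of a word before each of its left-to-right maxima: every block starts with
  its largest letter, and the first letters increase from block to block. Prepending the letter \<open>x\<close>
  makes \<open>x\<close> swallow the initial blocks whose first letter is smaller than \<open>x\<close>.
\<close>

fun blocks :: "nat list \<Rightarrow> nat list list" where
  "blocks [] = []"
| "blocks (x # xs) =
    (let bs = blocks xs
     in (x # concat (takeWhile (\<lambda>b. hd b < x) bs)) # dropWhile (\<lambda>b. hd b < x) bs)"

text \<open>
  The property that characterises the blocks of a word without repeated letters
  (\<open>block_form_blocks\<close> and \<open>blocks_concat\<close>).
\<close>

definition block_form :: "nat list list \<Rightarrow> bool" where
  "block_form bs \<longleftrightarrow>
     (\<forall>b\<in>set bs. b \<noteq> [] \<and> (\<forall>k\<in>set (tl b). k < hd b)) \<and> sorted_wrt (<) (map hd bs)"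

lemma concat_blocks [simp]: "concat (blocks w) = w"
proof (induction w)
  case (Cons x xs)
  then show ?case
    by (simp add: Let_def flip: concat_append)
qed simp

lemma block_nonempty: "b \<in> set (blocks w) \<Longrightarrow> b \<noteq> []"
  by (induction w) (auto simp: Let_def dest: set_dropWhileD)

lemma set_block: "b \<in> set (blocks w) \<Longrightarrow> set b \<subseteq> set w"
  using concat_blocks[of w] by (metis UN_upper set_concat)

lemma hd_block: "b \<in> set (blocks w) \<Longrightarrow> hd b \<in> set w"
  using set_block block_nonempty hd_in_set by blast

lemma block_form_blocks: "distinct w \<Longrightarrow> block_form (blocks w)"
proof (induction w)
  case (Cons x xs)
  define bs where "bs = blocks xs"
  define us where "us = takeWhile (\<lambda>b. hd b < x) bs"
  define vs where "vs = dropWhile (\<lambda>b. hd b < x) bs"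
  have bs: "block_form bs" "bs = us @ vs"
    using Cons by (simp_all add: bs_def us_def vs_def)
  have small: "k < x" if k: "k \<in> set (concat us)" for k
  proof -
    obtain b where b: "b \<in> set us" "k \<in> set b" using k by auto
    then have "hd b < x" unfolding us_def by (metis set_takeWhileD)
    moreover have "\<forall>k\<in>set (tl b). k < hd b" using b(1) bs by (auto simp: block_form_def)
    then have "k \<le> hd b" using b(2) by (cases b) auto
    ultimately show ?thesis by simp
  qed
  have large: "x < hd b" if "b \<in> set vs" for b
  proof -
    have ne: "vs \<noteq> []" using that by auto
    have "\<not> hd (hd vs) < x" using hd_dropWhile[of "\<lambda>b. hd b < x" bs] ne by (simp add: vs_def)
    moreover have "hd (hd vs) \<le> hd b"
      using that bs by (cases vs) (auto simp: block_form_def sorted_wrt_append)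
    moreover have "hd b \<in> set xs"
      using that bs hd_block[of b xs] by (simp add: bs_def)
    then have "hd b \<noteq> x" using Cons.prems by auto
    ultimately show ?thesis by simp
  qed
  have "blocks (x # xs) = (x # concat us) # vs"
    by (simp add: Let_def us_def vs_def bs_def)
  then show ?case
    using bs small large by (auto simp: block_form_def sorted_wrt_append)
qed (simp add: block_form_def)

lemma blocks_append:
  assumes "\<And>b k. b \<in> set (blocks v) \<Longrightarrow> k \<in> set u \<Longrightarrow> k < hd b"
  shows "blocks (u @ v) = blocks u @ blocks v"
  using assms
proof (induction u)
  case (Cons x u)
  have tw: "takeWhile (\<lambda>b. hd b < x) (blocks v) = []" "dropWhile (\<lambda>b. hd b < x) (blocks v) = blocks v"
    using Cons.prems by (cases "blocks v"; fastforce)+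
  have "blocks (u @ v) = blocks u @ blocks v"
    using Cons by simp
  moreover have "concat (takeWhile (\<lambda>b. hd b < x) (blocks u)) = u" if "\<forall>b\<in>set (blocks u). hd b < x"
    using that takeWhile_eq_all_conv[of "\<lambda>b. hd b < x" "blocks u"] by (metis concat_blocks)
  ultimately show ?case
    by (cases "\<forall>b\<in>set (blocks u). hd b < x") (auto simp: Let_def takeWhile_append dropWhile_append tw)
qed simp

lemma blocks_concat: "block_form bs \<Longrightarrow> blocks (concat bs) = bs"
proof (induction bs)
  case (Cons b bs)
  obtain m ks where b: "b = m # ks" and ks: "\<And>k. k \<in> set ks \<Longrightarrow> k < m"
    using Cons.prems by (cases b) (auto simp: block_form_def)
  have bs: "blocks (concat bs) = bs" "\<And>c. c \<in> set bs \<Longrightarrow> m < hd c"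
    using Cons by (auto simp: block_form_def b)
  have "blocks (ks @ concat bs) = blocks ks @ bs"
    using blocks_append[of "concat bs" ks] bs ks by fastforce
  moreover have "takeWhile (\<lambda>b. hd b < m) (blocks ks @ bs) = blocks ks"
    "dropWhile (\<lambda>b. hd b < m) (blocks ks @ bs) = bs"
    using ks hd_block[of _ ks] bs(2)
    by (cases bs; force simp: takeWhile_append dropWhile_append)+
  ultimately show ?case
    by (simp add: b Let_def)
qed (simp add: block_form_def)

lemma blocks_map:
  assumes "strict_mono_on (set w) h" shows "blocks (map h w) = map (map h) (blocks w)"
  using assms
proof (induction w)
  case (Cons x w)
  have IH: "blocks (map h w) = map (map h) (blocks w)"
    using Cons by (auto simp: strict_mono_on_def)
  have hd: "hd (map h b) < h x \<longleftrightarrow> hd b < x" if "b \<in> set (blocks w)" for b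
  proof -
    have "hd b \<in> set (x # w)" using hd_block[OF that] by simp
    then show ?thesis
      using strict_mono_on_less[OF Cons.prems, of "hd b" x] block_nonempty[OF that]
      by (simp add: hd_map)
  qed
  have "takeWhile (\<lambda>b. hd b < h x) (map (map h) (blocks w)) =
      map (map h) (takeWhile (\<lambda>b. hd b < x) (blocks w))"
    "dropWhile (\<lambda>b. hd b < h x) (map (map h) (blocks w)) =
      map (map h) (dropWhile (\<lambda>b. hd b < x) (blocks w))"
    using hd by (auto simp: takeWhile_map dropWhile_map comp_def
        intro!: arg_cong[of _ _ "map (map h)"] takeWhile_cong dropWhile_cong)
  then show ?case
    by (simp add: Let_def IH map_concat)
qed simp

text \<open>
  The left-normed commutator \<open>[\<dots>[[m, k\<^sub>1], k\<^sub>2], \<dots>]\<close> of the values of the letters of a nonempty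
  word, and the product of the left-normed commutators of the blocks of a word.
\<close>

definition left_normed :: "(nat \<Rightarrow> 'b::ring_1) \<Rightarrow> nat list \<Rightarrow> 'b" where
  "left_normed y b = foldl commutator (y (hd b)) (map y (tl b))"

definition block_product :: "(nat \<Rightarrow> 'b::ring_1) \<Rightarrow> nat list \<Rightarrow> 'b" where
  "block_product y w = prod_list (map (left_normed y) (blocks w))"

lemma (in central_hom) evalp_left_normed: "evalp y (left_normed X b) = left_normed y b"
proof -
  have "evalp y (foldl commutator f (map X ks)) = foldl commutator (evalp y f) (map y ks)" for f ks
    by (induction ks arbitrary: f) (simp_all add: commutator_def evalp_diff evalp_mult evalp_X)
  then show ?thesis by (simp add: left_normed_def evalp_X)
qed

lemma (in central_hom) evalp_block_product: "evalp y (block_product X w) = block_product y w"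
  by (simp add: block_product_def evalp_prod_list evalp_left_normed comp_def)

section \<open>Leading words\<close>

abbreviation word_less :: "nat list \<Rightarrow> nat list \<Rightarrow> bool" where
  "word_less u v \<equiv> (u, v) \<in> lex less_than"

lemma word_less_iff: "word_less u v \<longleftrightarrow>
    length u = length v \<and> (\<exists>xs a b u' v'. u = xs @ a # u' \<and> v = xs @ b # v' \<and> a < b)"
  by (auto simp: lex_conv)

text \<open>
  Sums of rearrangements of \<open>w\<close>, respectively of rearrangements that are smaller than \<open>w\<close>. No
  coefficients are needed in characteristic 2.
\<close>

definition sum_of_perms :: "nat list \<Rightarrow> 'k::field free_algebra \<Rightarrow> bool" where
  "sum_of_perms w f \<longleftrightarrow> (\<exists>R. f = sum_list (map mon R) \<and> (\<forall>r\<in>set R. mset r = mset w))"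

definition sum_below :: "nat list \<Rightarrow> 'k::field free_algebra \<Rightarrow> bool" where
  "sum_below w f \<longleftrightarrow>
     (\<exists>R. f = sum_list (map mon R) \<and> (\<forall>r\<in>set R. mset r = mset w \<and> word_less r w))"

lemma sum_below_0: "sum_below w 0"
  unfolding sum_below_def by (rule exI[of _ "[]"]) simp

lemma sum_below_add: "sum_below w f \<Longrightarrow> sum_below w g \<Longrightarrow> sum_below w (f + g)"
  unfolding sum_below_def by (elim exE, rule_tac x="R @ Ra" in exI) auto

lemma sum_of_perms_mon: "mset r = mset w \<Longrightarrow> sum_of_perms w (mon r)"
  unfolding sum_of_perms_def by (rule exI[of _ "[r]"]) simp

lemma sum_of_perms_add: "sum_of_perms w f \<Longrightarrow> sum_of_perms w g \<Longrightarrow> sum_of_perms w (f + g)"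
  unfolding sum_of_perms_def by (elim exE, rule_tac x="R @ Ra" in exI) auto

lemma sum_of_perms_if_below: "sum_below w f \<Longrightarrow> sum_of_perms w f"
  unfolding sum_below_def sum_of_perms_def by blast

lemma sum_list_mon_mult:
  "sum_list (map mon R) * sum_list (map mon S) =
    (sum_list (map mon (concat (map (\<lambda>r. map ((@) r) S) R))) :: 'k::field free_algebra)"
proof (induction R)
  case (Cons r R)
  have "mon r * sum_list (map mon S) = sum_list (map (\<lambda>s. mon (r @ s) :: 'k free_algebra) S)"
    by (simp add: mon_append sum_list_const_mult)
  then show ?case by (simp add: distrib_right Cons comp_def)
qed simp

lemma sum_below_mult_left:
  assumes "sum_below u f" "sum_of_perms v g" shows "sum_below (u @ v) (f * g)"
proof -
  obtain R S where R: "f = sum_list (map mon R)" "\<And>r. r \<in> set R \<Longrightarrow> mset r = mset u \<and> word_less r u"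
    and S: "g = sum_list (map mon S)" "\<And>s. s \<in> set S \<Longrightarrow> mset s = mset v"
    using assms unfolding sum_below_def sum_of_perms_def by blast
  have "word_less (r @ s) (u @ v)" if "r \<in> set R" "s \<in> set S" for r s
    using R(2)[OF that(1)] mset_eq_length[OF S(2)[OF that(2)]] by (fastforce simp: word_less_iff)
  then show ?thesis
    unfolding sum_below_def
    by (intro exI[of _ "concat (map (\<lambda>r. map ((@) r) S) R)"]) (auto simp: R S sum_list_mon_mult)
qed

lemma sum_below_mult_right:
  assumes "sum_below v g" shows "sum_below (u @ v) (mon u * g)"
proof -
  obtain S where S: "g = sum_list (map mon S)" "\<And>s. s \<in> set S \<Longrightarrow> mset s = mset v \<and> word_less s v"
    using assms unfolding sum_below_def by blast
  have "word_less (u @ s) (u @ v)" if "s \<in> set S" for s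
    using S(2)[OF that] by (fastforce simp: word_less_iff append_assoc[symmetric] simp del: append_assoc)
  then show ?thesis
    unfolding sum_below_def using sum_list_mon_mult[of "[u]" S, where 'k='a]
    by (intro exI[of _ "map ((@) u) S"]) (auto simp: S comp_def)
qed

context
  assumes char: "CHAR('k::field) = 2"
begin

text \<open>
  Expanding the commutator, every word other than \<open>m # ks\<close> starts with a letter of \<open>ks\<close>, and these are
  smaller than \<open>m\<close>.
\<close>

lemma leading_word_left_normed:
  assumes "\<And>k. k \<in> set ks \<Longrightarrow> k < m"
  shows "\<exists>f :: 'k free_algebra. left_normed X (m # ks) = mon (m # ks) + f \<and> sum_below (m # ks) f"
  using assms
proof (induction ks rule: rev_induct)
  case Nil
  show ?case
    using sum_below_0 by (intro exI[of _ 0]) (simp add: left_normed_def mon_def X_def)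
next
  case (snoc k ks)
  then obtain f :: "'k free_algebra" where
    f: "left_normed X (m # ks) = mon (m # ks) + f" "sum_below (m # ks) f"
    by auto
  have X_k: "X k = (mon [k] :: 'k free_algebra)" by (simp add: X_def mon_def)
  have perms: "sum_of_perms (m # ks) (mon (m # ks) + f)"
    by (intro sum_of_perms_add sum_of_perms_mon sum_of_perms_if_below f refl)
  define g where "g = f * mon [k] + mon [k] * (mon (m # ks) + f)"
  have "left_normed X (m # ks @ [k]) = commutator (left_normed X (m # ks)) (X k :: 'k free_algebra)"
    by (simp add: left_normed_def)
  also have "\<dots> = mon (m # ks) * mon [k] + g"
    by (simp add: f commutator_def minus_char_2[OF free_algebra_double[OF char]] X_k g_def algebra_simps)
  also have "mon (m # ks) * mon [k] = (mon (m # ks @ [k]) :: 'k free_algebra)"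
    by (simp flip: mon_append)
  finally have eq: "left_normed X (m # ks @ [k]) = mon (m # ks @ [k]) + g" .
  obtain R where R: "mon (m # ks) + f = sum_list (map mon R)" "\<And>r. r \<in> set R \<Longrightarrow> mset r = mset (m # ks)"
    using perms unfolding sum_of_perms_def by blast
  have "word_less (k # r) (m # ks @ [k])" if "r \<in> set R" for r
    using mset_eq_length[OF R(2)[OF that]] snoc.prems[of k] by simp
  then have "sum_below (m # ks @ [k]) (mon [k] * (mon (m # ks) + f))"
    unfolding sum_below_def using R sum_list_mon_mult[of "[[k]]" R, where 'k='k]
    by (intro exI[of _ "map ((#) k) R"]) (auto simp: comp_def)
  moreover have "sum_below (m # ks @ [k]) (f * mon [k])"
    using sum_below_mult_left[OF f(2) sum_of_perms_mon[of "[k]" "[k]"]] by simp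
  ultimately have "sum_below (m # ks @ [k]) g"
    unfolding g_def by (intro sum_below_add)
  with eq show ?case by blast
qed

lemma leading_word_block_product:
  assumes "distinct w"
  shows "\<exists>f :: 'k free_algebra. block_product X w = mon w + f \<and> sum_below w f"
proof -
  have "\<exists>f :: 'k free_algebra.
      prod_list (map (left_normed X) bs) = mon (concat bs) + f \<and> sum_below (concat bs) f"
    if "block_form bs" for bs
    using that
  proof (induction bs)
    case Nil
    show ?case using sum_below_0 by (intro exI[of _ 0]) (simp add: mon_Nil)
  next
    case (Cons b bs)
    obtain m ks where b: "b = m # ks" "\<And>k. k \<in> set ks \<Longrightarrow> k < m"
      using Cons.prems by (cases b) (auto simp: block_form_def)
    obtain f :: "'k free_algebra" where f: "left_normed X b = mon b + f" "sum_below b f"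
      using leading_word_left_normed[of ks m] b by blast
    obtain g :: "'k free_algebra" where
      g: "prod_list (map (left_normed X) bs) = mon (concat bs) + g" "sum_below (concat bs) g"
      using Cons by (auto simp: block_form_def)
    have "sum_below (b @ concat bs) (mon b * g + f * (mon (concat bs) + g))"
      by (intro sum_below_add sum_below_mult_right sum_below_mult_left f g
          sum_of_perms_add sum_of_perms_mon sum_of_perms_if_below refl)
    moreover have "prod_list (map (left_normed X) (b # bs)) =
        mon (b @ concat bs) + (mon b * g + f * (mon (concat bs) + g))"
      by (simp add: f g mon_append algebra_simps)
    ultimately show ?case by auto
  qed
  from this[OF block_form_blocks[OF assms]] show ?thesis
    by (simp add: block_product_def)
qed

end

section \<open>Pattern containment and straightening\<close>

text \<open>
  Classical pattern containment: \<open>w\<close> has a subsequence whose letters are ordered like those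
  of \<open>p\<close>. The letters of a pattern need not be consecutive in \<open>w\<close>.
\<close>

definition contains :: "nat list \<Rightarrow> nat list \<Rightarrow> bool" where
  "contains p w \<longleftrightarrow> (\<exists>x. strict_mono_on (set p) x \<and> subseq (map x p) w)"

lemma contains_subseq: "contains p u \<Longrightarrow> subseq u w \<Longrightarrow> contains p w"
  unfolding contains_def using subseq_order.trans by blast

lemma contains_map:
  assumes "contains p w" and h: "strict_mono_on (set w) h" shows "contains p (map h w)"
proof -
  obtain x where x: "strict_mono_on (set p) x" "subseq (map x p) w"
    using assms by (auto simp: contains_def)
  have "x i \<in> set w" if "i \<in> set p" for i
    using that x(2) by (metis image_eqI list.set_map notin_set_nthsI set_nths_subset subseq_conv_nths subsetD)
  then have "strict_mono_on (set p) (h \<circ> x)"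
    using x(1) h by (simp add: strict_mono_on_def)
  moreover have "subseq (map (h \<circ> x) p) (map h w)"
    using subseq_map[OF x(2), of h] by (simp add: comp_def)
  ultimately show ?thesis by (auto simp: contains_def)
qed

text \<open>
  The letters between two consecutive chosen letters are attached to the first of the two. This is how an
  occurrence of a pattern becomes a substitution of words for the variables of an identity.
\<close>

lemma subseq_factorisation:
  assumes "subseq s w"
  shows "\<exists>u bs. w = u @ concat bs \<and> list_all2 (\<lambda>x b. b \<noteq> [] \<and> hd b = x) s bs"
  using assms
proof (induction rule: list_emb.induct)
  case (list_emb_Nil w)
  show ?case by (intro exI[of _ w] exI[of _ "[]"]) simp
next
  case (list_emb_Cons s w y)
  then obtain u bs where "w = u @ concat bs" "list_all2 (\<lambda>x b. b \<noteq> [] \<and> hd b = x) s bs" by blast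
  then show ?case by (intro exI[of _ "y # u"] exI[of _ bs]) simp
next
  case (list_emb_Cons2 x y s w)
  then obtain u bs where "w = u @ concat bs" "list_all2 (\<lambda>x b. b \<noteq> [] \<and> hd b = x) s bs" by blast
  then show ?case using list_emb_Cons2 by (intro exI[of _ "[]"] exI[of _ "(y # u) # bs"]) simp
qed

lemma contains_factorisation:
  assumes "contains p w" and p: "distinct p"
  obtains u Y where "w = u @ concat (map Y p)" and "\<And>i. i \<in> set p \<Longrightarrow> Y i \<noteq> []"
    and "\<And>i j. i \<in> set p \<Longrightarrow> j \<in> set p \<Longrightarrow> i < j \<Longrightarrow> hd (Y i) < hd (Y j)"
proof -
  obtain x where x: "strict_mono_on (set p) x" "subseq (map x p) w"
    using assms by (auto simp: contains_def)
  obtain u bs where u: "w = u @ concat bs" and bs: "list_all2 (\<lambda>x b. b \<noteq> [] \<and> hd b = x) (map x p) bs"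
    using subseq_factorisation[OF x(2)] by blast
  have len: "length bs = length p" using list_all2_lengthD[OF bs] by simp
  define Y where "Y i = the (map_of (zip p bs) i)" for i
  have Y: "Y (p ! k) = bs ! k" if "k < length p" for k
    using that len p by (simp add: Y_def map_of_zip_nth)
  have "map Y p = bs"
    by (rule nth_equalityI) (simp_all add: len Y)
  moreover have hd: "Y i \<noteq> [] \<and> hd (Y i) = x i" if i: "i \<in> set p" for i
  proof -
    obtain k where "k < length p" "i = p ! k" using i by (metis in_set_conv_nth)
    then show ?thesis using list_all2_nthD[OF bs, of k] Y by simp
  qed
  ultimately show thesis
    using that[of u Y] u x(1) by (simp add: strict_mono_on_def)
qed

text \<open>
  A triple \<open>(Q, args, v)\<close> stands for the polynomial \<open>word_sum Q\<close> with the words \<open>args\<close> substituted for the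
  variables \<open>1, 2, \<dots>\<close>, multiplied on the right by the word \<open>v\<close>; \<open>instance_words\<close> lists its words. A
  certificate is a sum of such instances.
\<close>

type_synonym certificate = "(nat list list \<times> nat list list \<times> nat list) list"

fun instance_words :: "nat list list \<times> nat list list \<times> nat list \<Rightarrow> nat list list" where
  "instance_words (Q, args, v) = map (\<lambda>q. concat (map (\<lambda>i. args ! (i - 1)) q) @ v) Q"

text \<open>
  The list \<open>cancel T []\<close> consists of the words that occur an odd number of times in \<open>T\<close>.
\<close>

fun cancel :: "nat list list \<Rightarrow> nat list list \<Rightarrow> nat list list" where
  "cancel [] R = R"
| "cancel (q # T) R = cancel T (if q \<in> set R then remove1 q R else q # R)"

fun word_lt :: "nat list \<Rightarrow> nat list \<Rightarrow> bool" where
  "word_lt (a # u) (b # v) = (if a < b then True else if a = b then word_lt u v else False)"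
| "word_lt u v = False"

text \<open>
  The certificate \<open>C\<close> expands to rearrangements of the pattern \<open>p\<close>, and after cancellation \<open>p\<close> is the only one
  that is not smaller than \<open>p\<close>.
\<close>

fun valid_rule :: "nat list \<times> certificate \<Rightarrow> bool" where
  "valid_rule (p, C) =
    (let T = concat (map instance_words C)
     in distinct p \<and> list_all (\<lambda>r. length r = length p \<and> list_all (\<lambda>i. i \<in> set r) p) T \<and>
        cancel (filter (\<lambda>r. \<not> word_lt r p) T) [] = [p])"

text \<open>
  The minimal patterns for the leading words in degrees 4 to 7, found by linear algebra over the
  field with two elements, each with a certificate. The last certificate is the sum of the one for
  \<open>[3,2,5,1,6,4]\<close> with the words \<open>[5]\<close> and \<open>[4,7]\<close> substituted for its variables 4 and 5, and of
  that one multiplied on the right by the letter 7.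
\<close>

definition straightening_rules :: "(nat list \<times> certificate) list" where
  "straightening_rules = [
    ([4,3,2,1],
      [(st4_words, [[1],[2],[3],[4]], [])]),
    ([3,2,5,4,1],
      [(st4_words, [[1],[2],[3],[4,5]], []),
       (st4_words, [[1],[2],[3],[5,4]], []),
       (T5_words, [[4],[5],[1],[2],[3]], [])]),
    ([4,2,1,5,3],
      [(S5_words, [[1],[2],[3],[4],[5]], [])]),
    ([4,2,5,1,3],
      [(S5_words, [[2],[1],[3],[4],[5]], [])]),
    ([4,2,5,3,1],
      [(st4_words, [[1],[2],[4],[5,3]], []),
       (st4_words, [[1],[2],[3,5],[4]], []),
       (T5_words, [[3],[5],[1],[2],[4]], [])]),
    ([4,3,1,5,2],
      [(S5_words, [[1],[2],[4],[3],[5]], [])]),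
    ([4,3,5,1,2],
      [(S5_words, [[3],[1],[2],[4],[5]], [])]),
    ([5,1,3,2,4],
      [(S5_words, [[1],[2],[4],[5],[3]], []),
       (T5_words, [[1],[2],[3],[4],[5]], [])]),
    ([5,1,4,2,3],
      [(S5_words, [[1],[2],[3],[5],[4]], []),
       (S5_words, [[1],[2],[4],[5],[3]], [])]),
    ([5,2,1,4,3],
      [(S5_words, [[1],[2],[3],[5],[4]], [])]),
    ([5,2,3,1,4],
      [(S5_words, [[2],[1],[4],[5],[3]], [])]),
    ([5,2,4,1,3],
      [(S5_words, [[2],[1],[3],[5],[4]], [])]),
    ([5,3,1,4,2],
      [(S5_words, [[1],[2],[5],[3],[4]], [])]),
    ([5,3,4,1,2],
      [(S5_words, [[3],[1],[2],[5],[4]], [])]),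
    ([3,2,1,6,4,5],
      [(S5_words, [[2],[1],[4],[3],[6]], [5]),
       (S5_words, [[2],[1,5],[4],[3],[6]], []),
       (S5_words, [[3],[1],[4],[2],[6]], [5]),
       (S5_words, [[3],[1,5],[4],[2],[6]], [])]),
    ([3,2,1,6,5,4],
      [(S5_words, [[2],[1],[4],[3],[5]], [6]),
       (S5_words, [[2],[1,6],[4],[3],[5]], []),
       (S5_words, [[3],[1],[4],[2],[5]], [6]),
       (S5_words, [[3],[1,6],[4],[2],[5]], [])]),
    ([3,2,5,1,6,4],
      [(S5_words, [[1],[2],[6],[3],[4]], [5]),
       (S5_words, [[1],[2,5],[6],[3],[4]], []),
       (S5_words, [[1],[2],[6],[3],[5]], [4]),
       (S5_words, [[1],[2,4],[6],[3],[5]], [])]),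
    ([3,2,6,1,5,4],
      [(S5_words, [[1],[2],[4],[3],[5]], [6]),
       (S5_words, [[1],[2,6],[4],[3],[5]], []),
       (S5_words, [[1],[2],[4],[3],[6]], [5]),
       (S5_words, [[1],[2,5],[4],[3],[6]], [])]),
    ([4,1,6,3,2,5],
      [(S5_words, [[3],[1],[2],[4],[6]], [5]),
       (S5_words, [[4],[1],[2],[3],[6]], [5]),
       (S5_words, [[1],[2],[4],[3],[6]], [5]),
       (S5_words, [[3],[1,5],[2],[4],[6]], []),
       (S5_words, [[4],[1,5],[2],[3],[6]], []),
       (S5_words, [[1,5],[2],[4],[3],[6]], [])]),
    ([4,2,1,3,6,5],
      [(S5_words, [[1],[2],[3],[4],[5]], [6]),
       (S5_words, [[1],[2],[3,6],[4],[5]], [])]),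
    ([4,2,3,1,6,5],
      [(S5_words, [[1],[2],[5],[4],[6]], [3]),
       (S5_words, [[1],[2,3],[5],[4],[6]], []),
       (T5_words, [[1],[4],[2],[3],[5]], [6]),
       (T5_words, [[1],[4],[2,6],[3],[5]], [])]),
    ([4,3,1,2,6,5],
      [(S5_words, [[1],[2],[4],[3],[5]], [6]),
       (S5_words, [[1],[2,6],[4],[3],[5]], [])]),
    ([3,2,5,1,4,7,6],
      [(S5_words, [[1],[2],[6],[3],[5]], [4,7]),
       (S5_words, [[1],[2,4,7],[6],[3],[5]], []),
       (S5_words, [[1],[2],[6],[3],[4,7]], [5]),
       (S5_words, [[1],[2,5],[6],[3],[4,7]], []),
       (S5_words, [[1],[2],[6],[3],[4]], [5,7]),
       (S5_words, [[1],[2,5],[6],[3],[4]], [7]),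
       (S5_words, [[1],[2],[6],[3],[5]], [4,7]),
       (S5_words, [[1],[2,4],[6],[3],[5]], [7])])]"

lemma valid_straightening_rules: "list_all valid_rule straightening_rules"
  by code_simp

lemma straightening_rules_words:
  assumes "(p, C) \<in> set straightening_rules" and "(Q, args, v) \<in> set C"
  shows "Q \<in> {st4_words, S5_words, T5_words}"
proof -
  have "list_all (\<lambda>(p, C). list_all (\<lambda>(Q, args, v). Q \<in> {st4_words, S5_words, T5_words}) C) straightening_rules"
    by (simp add: straightening_rules_def)
  then show ?thesis using assms by (fastforce simp: list_all_iff)
qed

text \<open>
  A word is normal if it contains no pattern of a straightening rule.
\<close>

definition normal_word :: "nat list \<Rightarrow> bool" where
  "normal_word w \<longleftrightarrow> (\<forall>p\<in>set (map fst straightening_rules). \<not> contains p w)"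

lemma normal_word_subseq: "normal_word w \<Longrightarrow> subseq u w \<Longrightarrow> normal_word u"
  unfolding normal_word_def using contains_subseq by blast

lemma normal_word_map:
  "normal_word (map h w) \<Longrightarrow> strict_mono_on (set w) h \<Longrightarrow> normal_word w"
  unfolding normal_word_def using contains_map by blast

lemma word_lt_imp_word_less: "word_lt r p \<Longrightarrow> length r = length p \<Longrightarrow> word_less r p"
  by (induction r p rule: word_lt.induct) (auto split: if_splits)

lemma word_sum_instance_words:
  "word_sum (instance_words (Q, args, v)) z =
    word_sum Q (\<lambda>i. prod_list (map z (args ! (i - 1)))) * prod_list (map z v)"
proof -
  have "prod_list (map z (concat (map F q))) = prod_list (map (\<lambda>i. prod_list (map z (F i))) q)"
    for F :: "nat \<Rightarrow> nat list" and q :: "nat list"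
    by (induction q) simp_all
  then show ?thesis
    by (simp add: word_sum_def comp_def flip: sum_list_mult_const)
qed

lemma word_sum_cancel:
  assumes "\<And>x :: 'b::ring_1. x + x = 0"
  shows "word_sum (cancel T R) z = (word_sum T z + word_sum R z :: 'b)"
proof (induction T arbitrary: R)
  case (Cons q T)
  have "word_sum (if q \<in> set R then remove1 q R else q # R) z = (prod_list (map z q) + word_sum R z :: 'b)"
  proof (cases "q \<in> set R")
    case True
    then have "word_sum R z = (prod_list (map z q) + word_sum (remove1 q R) z :: 'b)"
      unfolding word_sum_def by (rule sum_list_map_remove1)
    then show ?thesis using True by (simp add: double_left[OF assms])
  qed (simp add: word_sum_def)
  then show ?case using Cons by (simp add: word_sum_def add_ac)
qed (simp add: word_sum_def)

lemma word_sum_filter: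
  "word_sum T z = word_sum (filter P T) z + (word_sum (filter (\<lambda>q. \<not> P q) T) z :: 'b::ring_1)"
  by (induction T) (simp_all add: word_sum_def add_ac)

text \<open>
  Substituting words whose first letters are in the order of the indices preserves the
  lexicographic order.
\<close>

lemma word_less_concat_map:
  assumes "word_less r p" and "mset r = mset p" and "\<And>i. i \<in> set p \<Longrightarrow> Y i \<noteq> []"
    and "\<And>i j. i \<in> set p \<Longrightarrow> j \<in> set p \<Longrightarrow> i < j \<Longrightarrow> hd (Y i) < (hd (Y j) :: nat)"
  shows "mset (concat (map Y r)) = mset (concat (map Y p))" and "word_less (concat (map Y r)) (concat (map Y p))"
proof -
  have ms: "mset (concat (map Y q)) = \<Sum>\<^sub># (image_mset (\<lambda>i. mset (Y i)) (mset q))" for q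
    by (simp add: mset_concat comp_def flip: mset_map sum_mset_sum_list)
  show eq: "mset (concat (map Y r)) = mset (concat (map Y p))"
    by (simp only: ms assms(2))
  obtain xs a b r' p' where d: "r = xs @ a # r'" "p = xs @ b # p'" "a < b"
    using assms(1) unfolding word_less_iff by blast
  have "a \<in> set p" "b \<in> set p"
    using d mset_eq_setD[OF assms(2)] by auto
  then obtain a' A b' B where "Y a = a' # A" "Y b = b' # B" "a' < b'"
    using assms(3,4) d(3) by (metis list.collapse)
  then show "word_less (concat (map Y r)) (concat (map Y p))"
    unfolding word_less_iff using mset_eq_length[OF eq] d by fastforce
qed

context
  fixes I :: "'k::field free_algebra set"
  assumes char: "CHAR('k) = 2" and I: "T_ideal I"
    and st4: "st4 \<in> I" and S5: "S5 \<in> I" and T5: "T5 \<in> I"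
begin

text \<open>
  Modulo \<open>I\<close>, a word that contains a pattern is a sum of smaller rearrangements of it.
\<close>

lemma contains_straighten:
  assumes "(p, C) \<in> set straightening_rules" and "contains p w"
  shows "\<exists>f. mon w + f \<in> I \<and> sum_below w f"
proof -
  note double = free_algebra_double[OF char]
  define T where "T = concat (map instance_words C)"
  define R where "R = filter (\<lambda>r. word_lt r p) T"
  have valid: "valid_rule (p, C)"
    using assms(1) valid_straightening_rules by (auto simp: list_all_iff)
  then have p: "distinct p" "cancel (filter (\<lambda>r. \<not> word_lt r p) T) [] = [p]"
    by (simp_all add: T_def Let_def)
  have R: "mset r = mset p \<and> word_less r p" if "r \<in> set R" for r
  proof -
    have r: "length r = length p" "set p \<subseteq> set r" "word_lt r p"
      using valid that by (auto simp: R_def T_def Let_def list_all_iff)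
    have "card (set r) \<le> card (set p)"
      using r(1) p(1) by (metis card_length distinct_card)
    then have "set p = set r" using r(2) by (simp add: card_subset_eq card_mono le_antisym)
    then have "distinct r" using p(1) r(1) by (metis card_distinct distinct_card)
    then show ?thesis
      using p(1) r \<open>set p = set r\<close> by (simp add: word_lt_imp_word_less flip: set_eq_iff_mset_eq_distinct)
  qed
  have words: "word_sum Q y \<in> I" if "Q \<in> {st4_words, S5_words, T5_words}" for Q y
    using that st4 S5 T5 T_ideal_word_sum[OF I]
    by (auto simp: st4_eq_word_sum[OF char] S5_eq_word_sum[OF char] T5_eq_word_sum[OF char])
  have "word_sum (concat (map instance_words D)) y \<in> I" if "set D \<subseteq> set C" for D y
    using that
  proof (induction D)
    case Nil
    show ?case by (simp add: word_sum_def T_ideal_0[OF I])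
  next
    case (Cons d D)
    obtain Q args v where d: "d = (Q, args, v)" by (cases d)
    then have "Q \<in> {st4_words, S5_words, T5_words}"
      using straightening_rules_words[OF assms(1)] Cons.prems by auto
    then have "word_sum (instance_words d) y \<in> I"
      unfolding d word_sum_instance_words by (intro T_ideal_mult_right[OF I] words)
    then show ?case
      using Cons T_ideal_add[OF I] by (simp add: word_sum_def)
  qed
  then have T_in_I: "word_sum T y \<in> I" for y
    by (simp add: T_def)
  have "prod_list (map y p) + word_sum R y = word_sum T y" for y :: "nat \<Rightarrow> 'k free_algebra"
    using word_sum_cancel[OF double, of "filter (\<lambda>r. \<not> word_lt r p) T" "[]" y]
      word_sum_filter[of T y "\<lambda>r. word_lt r p"]
    by (simp add: p R_def word_sum_def add.commute)
  with T_in_I have in_I: "prod_list (map y p) + word_sum R y \<in> I" for y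
    by simp
  obtain u Y where w: "w = u @ concat (map Y p)" and Y: "\<And>i. i \<in> set p \<Longrightarrow> Y i \<noteq> []"
      "\<And>i j. i \<in> set p \<Longrightarrow> j \<in> set p \<Longrightarrow> i < j \<Longrightarrow> hd (Y i) < hd (Y j)"
    using contains_factorisation[OF assms(2) p(1)] by metis
  have prod_mon: "prod_list (map (\<lambda>i. mon (Y i)) q) = (mon (concat (map Y q)) :: 'k free_algebra)" for q
    by (induction q) (simp_all add: mon_Nil mon_append)
  define f :: "'k free_algebra" where "f = sum_list (map (\<lambda>r. mon (concat (map Y r))) R)"
  have "mon (concat (map Y p)) + f \<in> I"
    using in_I[of "\<lambda>i. mon (Y i)"] by (simp add: word_sum_def f_def prod_mon)
  then have "mon w + mon u * f \<in> I"
    using T_ideal_mult_left[OF I, of _ "mon u"] by (simp add: w mon_append flip: distrib_left)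
  moreover have "sum_below (concat (map Y p)) f"
    unfolding sum_below_def f_def
    using word_less_concat_map[OF _ _ Y] R
    by (intro exI[of _ "map (\<lambda>r. concat (map Y r)) R"]) (auto simp: comp_def)
  then have "sum_below w (mon u * f)"
    unfolding w by (rule sum_below_mult_right)
  ultimately show ?thesis by blast
qed

theorem words_spanned_by_block_products:
  assumes V: "finite V" and "w \<in> permutations_of_set V"
    and add: "\<And>f g. f \<in> U \<Longrightarrow> g \<in> U \<Longrightarrow> f + g \<in> U" and "I \<subseteq> U"
    and normal: "\<And>v. v \<in> permutations_of_set V \<Longrightarrow> normal_word v \<Longrightarrow> block_product X v \<in> U"
  shows "mon w \<in> U"
  using assms(2)
proof (induction w rule: wf_induct_rule[OF wf_lex[OF wf_less_than]])
  case (1 w)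
  have w: "set w = V" "distinct w"
    using 1 by (simp_all add: permutations_of_set_def)
  have below: "f \<in> U" if "sum_below w f" for f
  proof -
    obtain R where R: "f = sum_list (map mon R)" "\<And>r. r \<in> set R \<Longrightarrow> mset r = mset w \<and> word_less r w"
      using \<open>sum_below w f\<close> unfolding sum_below_def by blast
    have "mon r \<in> U" if "r \<in> set R" for r
      using R(2)[OF that] w 1
      by (metis mset_eq_imp_distinct_iff mset_eq_setD permutations_of_setI)
    then have "sum_list (map mon R) \<in> U"
      using add T_ideal_0[OF I] \<open>I \<subseteq> U\<close> by (induction R) auto
    then show ?thesis by (simp add: R)
  qed
  have "\<exists>f. mon w + f \<in> U \<and> sum_below w f"
  proof (cases "normal_word w")
    case True
    then have "block_product X w \<in> U" using normal 1 by blast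
    then show ?thesis using leading_word_block_product[OF char w(2)] by fastforce
  next
    case False
    then show ?thesis using contains_straighten \<open>I \<subseteq> U\<close> unfolding normal_word_def by fastforce
  qed
  then obtain f where f: "mon w + f \<in> U" "sum_below w f" by blast
  have "mon w = (mon w + f) + f"
    by (simp add: add.assoc free_algebra_double[OF char])
  then show ?case using add[OF f(1) below[OF f(2)]] by metis
qed

end

section \<open>Proper normal words of length at most seven\<close>

text \<open>
  A word is proper if none of its blocks is a single letter. Its block product is then a
  product of proper commutators, which vanishes as soon as one of the variables is 1.
\<close>

definition proper :: "nat list \<Rightarrow> bool" where
  "proper w \<longleftrightarrow> (\<forall>b\<in>set (blocks w). tl b \<noteq> [])"

definition proper_normal_words :: "nat set \<Rightarrow> nat list set" where
  "proper_normal_words V = {w \<in> permutations_of_set V. proper w \<and> normal_word w}"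

definition patterns :: "nat list list" where
  "patterns = [
    [4,3,2,1], [3,2,5,4,1], [4,2,1,5,3], [4,2,5,1,3], [4,2,5,3,1], [4,3,1,5,2], [4,3,5,1,2], [5,1,3,2,4],
    [5,1,4,2,3], [5,2,1,4,3], [5,2,3,1,4], [5,2,4,1,3], [5,3,1,4,2], [5,3,4,1,2], [3,2,1,6,4,5],
    [3,2,1,6,5,4], [3,2,5,1,6,4], [3,2,6,1,5,4], [4,1,6,3,2,5], [4,2,1,3,6,5], [4,2,3,1,6,5], [4,3,1,2,6,5],
    [3,2,5,1,4,7,6]]"

lemma patterns_eq: "patterns = map fst straightening_rules"
  by (simp add: patterns_def straightening_rules_def)

lemma distinct_pattern: "p \<in> set patterns \<Longrightarrow> distinct p"
  using valid_straightening_rules by (auto simp: patterns_eq list_all_iff Let_def)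

text \<open>
  A backtracking search for an occurrence of a pattern. The list \<open>m\<close> records the letters of the pattern that are
  already matched, with their images. Only its soundness matters, so completeness is not shown.
\<close>

fun compatible :: "nat \<Rightarrow> nat \<Rightarrow> (nat \<times> nat) list \<Rightarrow> bool" where
  "compatible p x [] = True"
| "compatible p x ((q, y) # r) =
    (if (if q < p then y < x else x < y) then compatible p x r else False)"

fun embeds :: "(nat \<times> nat) list \<Rightarrow> nat list \<Rightarrow> nat list \<Rightarrow> bool" where
  "embeds m [] w = True"
| "embeds m (p # ps) [] = False"
| "embeds m (p # ps) (x # w) =
    (if (if compatible p x m then embeds ((p, x) # m) ps w else False) then True
     else embeds m (p # ps) w)"

fun reducible :: "nat list list \<Rightarrow> nat list \<Rightarrow> bool" where
  "reducible [] w = False"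
| "reducible (p # P) w = (if embeds [] p w then True else reducible P w)"

lemma embeds_sound:
  assumes "embeds m ps w"
  defines "R \<equiv> \<lambda>(q :: nat, y) (p, x). if q < p then y < x else x < (y :: nat)"
  shows "\<exists>vs. length vs = length ps \<and> subseq vs w \<and> sorted_wrt R (zip ps vs) \<and>
    (\<forall>a\<in>set m. \<forall>b\<in>set (zip ps vs). R a b)"
  using assms(1)
proof (induction m ps w rule: embeds.induct)
  case (3 m p ps x w)
  have comp: "\<forall>a\<in>set m. R a (p, x)" if "compatible p x m"
    using that by (induction m) (auto simp: R_def split: if_splits)
  show ?case
  proof (cases "compatible p x m \<and> embeds ((p, x) # m) ps w")
    case True
    then obtain vs where vs: "length vs = length ps" "subseq vs w" "sorted_wrt R (zip ps vs)"
        "\<forall>a\<in>set ((p, x) # m). \<forall>b\<in>set (zip ps vs). R a b"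
      using 3(1) by auto
    then show ?thesis
      using comp True by (intro exI[of _ "x # vs"]) auto
  next
    case False
    then obtain vs where vs: "length vs = length (p # ps)" "subseq vs w" "sorted_wrt R (zip (p # ps) vs)"
        "\<forall>a\<in>set m. \<forall>b\<in>set (zip (p # ps) vs). R a b"
      using 3(2,3) by (auto split: if_splits)
    then show ?thesis
      by (intro exI[of _ vs]) auto
  qed
qed auto

lemma embeds_imp_contains:
  assumes "embeds [] p w" and p: "distinct p"
  shows "contains p w"
proof -
  define R where "R = (\<lambda>(q :: nat, y) (p, x). if q < p then y < x else x < (y :: nat))"
  obtain vs where vs: "length vs = length p" "subseq vs w" "sorted_wrt R (zip p vs)"
    using embeds_sound[OF assms(1)] unfolding R_def by blast
  define x where "x i = the (map_of (zip p vs) i)" for i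
  have x: "x (p ! k) = vs ! k" if "k < length p" for k
    using that vs p by (simp add: x_def map_of_zip_nth)
  have "map x p = vs"
    by (rule nth_equalityI) (simp_all add: vs x)
  moreover have "strict_mono_on (set p) x"
  proof (rule strict_mono_onI)
    fix i j assume ij: "i \<in> set p" "j \<in> set p" "i < j"
    obtain k l where k: "k < length p" "i = p ! k" and l: "l < length p" "j = p ! l"
      using ij by (metis in_set_conv_nth)
    have R: "R (p ! a, vs ! a) (p ! b, vs ! b)" if "a < b" "b < length p" for a b
      using sorted_wrt_nth_less[OF vs(3), of a b] that vs(1) by simp
    have "k \<noteq> l" using k l ij by auto
    then show "x i < x j"
      using R[of k l] R[of l k] k l ij(3) x by (cases "k < l") (auto simp: R_def)
  qed
  ultimately show ?thesis
    using vs(2) by (auto simp: contains_def)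
qed

lemma reducible_imp_not_normal:
  assumes "reducible patterns w" shows "\<not> normal_word w"
proof -
  have "\<exists>p\<in>set P. embeds [] p w" if "reducible P w" for P
    using that by (induction P) (auto split: if_splits)
  then show ?thesis
    using assms embeds_imp_contains distinct_pattern unfolding normal_word_def patterns_eq by blast
qed

lemma blocks_max:
  assumes "\<And>k. k \<in> set u \<union> set v \<Longrightarrow> k < m"
  shows "blocks (u @ m # v) = blocks u @ [m # v]"
proof -
  have "\<forall>b\<in>set (blocks v). hd b < m" using hd_block assms by blast
  then have "takeWhile (\<lambda>b. hd b < m) (blocks v) = blocks v" and dw: "dropWhile (\<lambda>b. hd b < m) (blocks v) = []"
    by (simp_all add: takeWhile_eq_all_conv dropWhile_eq_Nil_conv)
  then have tw: "concat (takeWhile (\<lambda>b. hd b < m) (blocks v)) = v"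
    by (metis concat_blocks)
  have "blocks (m # v) = [m # v]"
    by (simp add: Let_def tw dw)
  then show ?thesis
    using blocks_append[of "m # v" u] assms by simp
qed

lemma proper_map:
  assumes "strict_mono_on (set w) h" shows "proper (map h w) \<longleftrightarrow> proper w"
  using block_nonempty by (auto simp: proper_def blocks_map[OF assms] map_tl[symmetric])

text \<open>
  The increasing map from the numbers \<open>1, 2, \<dots>\<close> onto those different from \<open>x\<close>.
\<close>

definition skip :: "nat \<Rightarrow> nat \<Rightarrow> nat" where
  "skip x i = (if i < x then i else i + 1)"

text \<open>
  Removing the last letter \<open>x\<close> of a proper normal word leaves a word that is proper up to a possible single last
  block, which is then the largest letter. This generates the proper normal words degree by degree.
\<close>

lemma proper_normal_words_step:
  assumes "w \<in> proper_normal_words {1..Suc n}"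
  obtains v x where "w = map (skip x) v @ [x]" "x \<in> {1..n}"
    "v \<in> proper_normal_words {1..n} \<or> (n \<ge> 1 \<and> (\<exists>u\<in>proper_normal_words {1..n - 1}. v = u @ [n]))"
proof -
  have w: "set w = {1..Suc n}" "distinct w" "proper w" "normal_word w"
    using assms by (simp_all add: proper_normal_words_def permutations_of_set_def)
  define m where "m = Suc n"
  obtain a b where ab: "w = a @ m # b"
    using w(1) split_list[of m w] by (auto simp: m_def)
  have less: "k < m" if "k \<in> set a \<union> set b" for k
  proof -
    have "k \<in> {1..Suc n}" using that w(1) ab by auto
    moreover have "k \<noteq> m" using that w(2) ab by auto
    ultimately show ?thesis by (simp add: m_def)
  qed
  \<comment> \<open>The last block starts with the largest letter; the earlier blocks do not change when the
    end of the word is cut off.\<close>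
  have blocks_w: "blocks w = blocks a @ [m # b]"
    unfolding ab by (rule blocks_max) (fact less)
  have "b \<noteq> []" using w(3) by (auto simp: proper_def blocks_w)
  then obtain b' x where b: "b = b' @ [x]" by (metis rev_exhaust)
  have x: "x \<in> {1..n}" using w(1) less[of x] ab b by (auto simp: m_def)
  define v' where "v' = a @ m # b'"
  have w': "w = v' @ [x]" by (simp add: ab b v'_def)
  define h where "h i = (if i < x then i else i - 1)" for i
  define v where "v = map h v'"
  have x_notin: "x \<notin> set v'" using w(2) w' by simp
  have h: "strict_mono_on (set v') h"
  proof (rule strict_mono_onI)
    fix i j assume ij: "i \<in> set v'" "j \<in> set v'" "i < j"
    then have "i \<noteq> x" "j \<noteq> x" using x_notin by auto
    then show "h i < h j" using ij(3) unfolding h_def by (cases "i < x"; cases "j < x"; simp; arith)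
  qed
  have skip_h: "map (skip x) v = v'"
    unfolding v_def map_map
  proof (intro map_idI)
    fix k assume "k \<in> set v'"
    then have "k \<noteq> x" using x_notin by auto
    then show "(skip x \<circ> h) k = k" unfolding comp_def skip_def h_def by (cases "k < x"; simp; arith)
  qed
  have skip: "strict_mono_on A (skip x)" for A
    by (intro strict_mono_onI) (auto simp: skip_def)
  have set_v': "set v' = {1..Suc n} - {x}" using w(1,2) w' by auto
  have "set v = {1..n}"
  proof -
    have "skip x ` set v = {1..Suc n} - {x}" using skip_h set_v' by (metis list.set_map)
    moreover have "skip x ` {1..n} = {1..Suc n} - {x}"
    proof (intro equalityI subsetI)
      fix i assume i: "i \<in> {1..Suc n} - {x}"
      then have "i = skip x (h i)" "h i \<in> {1..n}"
        using x by (auto simp: skip_def h_def)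
      then show "i \<in> skip x ` {1..n}" by blast
    qed (auto simp: skip_def)
    moreover have "inj (skip x)" by (auto simp: inj_def skip_def split: if_splits)
    ultimately show ?thesis by (metis inj_image_eq_iff)
  qed
  have "distinct v'" using w(2) w' by simp
  then have "distinct v" using skip_h by (metis distinct_map)
  have normal_v': "normal_word v'" using w(4) w' normal_word_subseq by (metis subseq_rev_drop_many prefix_imp_subseq prefixI)
  then have "normal_word v" using normal_word_map skip skip_h by metis
  note v = \<open>set v = {1..n}\<close> \<open>distinct v\<close> \<open>normal_word v\<close>
  have proper_a: "\<forall>c\<in>set (blocks a). tl c \<noteq> []"
    using w(3) by (auto simp: proper_def blocks_w)
  show thesis
  proof (cases "b' = []")
    case False
    have "blocks v' = blocks a @ [m # b']"
      unfolding v'_def by (rule blocks_max) (use less b in auto)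
    then have "proper v'" using proper_a False by (auto simp: proper_def)
    then have "proper v" unfolding v_def proper_map[OF h] .
    then have "v \<in> proper_normal_words {1..n}"
      using v by (simp add: proper_normal_words_def permutations_of_set_def)
    then show thesis using that[of x v] w' skip_h x by simp
  next
    case True
    define u where "u = map h a"
    have hm: "h m = n" using x by (simp add: h_def m_def)
    have v_eq: "v = u @ [n]" using hm by (simp add: v_def v'_def True u_def)
    have "proper u"
      unfolding u_def using proper_a h by (subst proper_map) (auto simp: proper_def v'_def strict_mono_on_def)
    moreover have "normal_word u"
      using v(3) normal_word_subseq v_eq by (metis prefix_imp_subseq prefixI)
    moreover have "set u = {1..n - 1}"
    proof -
      have "set u = {1..n} - {n}" using v(1,2) v_eq by auto
      also have "\<dots> = {1..n - 1}" by (rule set_eqI) (simp, arith)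
      finally show ?thesis .
    qed
    moreover have "distinct u" using v(2) v_eq by simp
    ultimately have "u \<in> proper_normal_words {1..n - 1}"
      by (simp add: proper_normal_words_def permutations_of_set_def)
    moreover have "w = map (skip x) v @ [x]" "1 \<le> n" using w' skip_h x by simp_all
    ultimately show thesis using that[of x v] x v_eq by blast
  qed
qed

section \<open>Independence on matrix units\<close>

datatype matrix_unit = U11 | U12 | U21 | U22

text \<open>
  Matrices over the field with two elements, with Boolean entries.
\<close>

definition bit_add :: "bool \<Rightarrow> bool \<Rightarrow> bool" where
  "bit_add a b = (if a then \<not> b else b)"

definition bit_mult :: "bool \<Rightarrow> bool \<Rightarrow> bool" where
  "bit_mult a b = (if a then b else False)"

fun bmat_add :: "bool m2 \<Rightarrow> bool m2 \<Rightarrow> bool m2" where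
  "bmat_add (M2 a b c d) (M2 a' b' c' d') =
    M2 (bit_add a a') (bit_add b b') (bit_add c c') (bit_add d d')"

fun bmat_mult :: "bool m2 \<Rightarrow> bool m2 \<Rightarrow> bool m2" where
  "bmat_mult (M2 a b c d) (M2 a' b' c' d') =
    M2 (bit_add (bit_mult a a') (bit_mult b c')) (bit_add (bit_mult a b') (bit_mult b d'))
      (bit_add (bit_mult c a') (bit_mult d c')) (bit_add (bit_mult c b') (bit_mult d d'))"

definition bmat_commutator :: "bool m2 \<Rightarrow> bool m2 \<Rightarrow> bool m2" where
  "bmat_commutator A B = bmat_add (bmat_mult A B) (bmat_mult B A)"

fun bmat_unit :: "matrix_unit \<Rightarrow> bool m2" where
  "bmat_unit U11 = M2 True False False False"
| "bmat_unit U12 = M2 False True False False"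
| "bmat_unit U21 = M2 False False True False"
| "bmat_unit U22 = M2 False False False True"

text \<open>
  A matrix unit also names the position of its nonzero entry.
\<close>

fun entry :: "matrix_unit \<Rightarrow> 'a m2 \<Rightarrow> 'a" where
  "entry U11 (M2 a b c d) = a"
| "entry U12 (M2 a b c d) = b"
| "entry U21 (M2 a b c d) = c"
| "entry U22 (M2 a b c d) = d"

text \<open>
  The value of block products when the variable \<open>i\<close> takes as its value the \<open>i\<close>-th member of a list of matrix units.
  Counting starts at 1, hence the index \<open>i - 1\<close>.
\<close>

fun bmat_left_normed :: "matrix_unit list \<Rightarrow> bool m2 \<Rightarrow> nat list \<Rightarrow> bool m2" where
  "bmat_left_normed us A [] = A"
| "bmat_left_normed us A (k # ks) =
    bmat_left_normed us (bmat_commutator A (bmat_unit (us ! (k - 1)))) ks"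

fun bmat_block_product :: "matrix_unit list \<Rightarrow> nat list list \<Rightarrow> bool m2" where
  "bmat_block_product us [] = M2 True False False True"
| "bmat_block_product us (b # bs) =
    bmat_mult (bmat_left_normed us (bmat_unit (us ! (hd b - 1))) (tl b)) (bmat_block_product us bs)"

text \<open>
  An entry \<open>(w, us, r)\<close> of an evaluation table says that at the matrix units \<open>us\<close> the block product of \<open>w\<close> has
  the entry 1 at position \<open>r\<close>; \<open>triangular\<close> demands that the block products of all later words of the table
  have the entry 0 there. The words are passed as lists of blocks.
\<close>

type_synonym evaluation_table = "(nat list \<times> matrix_unit list \<times> matrix_unit) list"

fun triangular :: "(nat list list \<times> matrix_unit list \<times> matrix_unit) list \<Rightarrow> bool" where
  "triangular [] = True"
| "triangular ((bs, us, r) # t) =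
    (if entry r (bmat_block_product us bs) then
       if list_all (\<lambda>(bs', _). \<not> entry r (bmat_block_product us bs')) t then triangular t else False
     else False)"

text \<open>
  The proper normal words of length up to 7, each with its evaluation point. The order comes from repeatedly
  picking an evaluation at which exactly one of the remaining words does not vanish.
\<close>

definition table_0 :: evaluation_table where "table_0 = [([], [], U11)]"
definition table_1 :: evaluation_table where "table_1 = []"
definition table_2 :: evaluation_table where
  "table_2 = [
    ([2,1],[U11,U12],U12)]"

definition table_3 :: evaluation_table where
  "table_3 = [
    ([3,1,2],[U11,U12,U21],U11), ([3,2,1],[U11,U12,U11],U12)]"

definition table_4 :: evaluation_table where
  "table_4 = [
    ([4,2,3,1],[U12,U11,U11,U21],U22), ([4,3,1,2],[U11,U11,U12,U11],U12), ([4,1,3,2],[U11,U12,U11,U21],U22),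
    ([4,2,1,3],[U11,U12,U11,U11],U12), ([2,1,4,3],[U11,U12,U21,U11],U11), ([3,1,4,2],[U11,U12,U21,U11],U22),
    ([3,2,4,1],[U12,U21,U11,U11],U22), ([4,1,2,3],[U11,U11,U11,U12],U12)]"

definition table_5 :: evaluation_table where
  "table_5 = [
    ([2,1,5,3,4],[U11,U12,U21,U11,U11],U11), ([3,1,5,2,4],[U11,U12,U21,U11,U11],U22),
    ([4,1,5,3,2],[U12,U12,U11,U21,U21],U11), ([5,1,3,4,2],[U11,U12,U11,U11,U21],U22),
    ([5,2,3,4,1],[U12,U11,U11,U11,U21],U22), ([5,3,1,2,4],[U11,U11,U12,U11,U11],U12),
    ([5,4,1,2,3],[U11,U11,U11,U12,U11],U12), ([4,1,2,5,3],[U11,U11,U12,U21,U11],U22),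
    ([5,1,2,4,3],[U11,U11,U12,U11,U21],U22), ([5,2,1,3,4],[U11,U12,U11,U11,U11],U12),
    ([3,2,5,1,4],[U12,U11,U21,U11,U11],U22), ([4,1,3,5,2],[U11,U12,U11,U21,U21],U21),
    ([5,1,2,3,4],[U11,U11,U11,U11,U12],U12), ([3,1,2,5,4],[U11,U12,U21,U12,U21],U11),
    ([3,2,1,5,4],[U11,U12,U11,U12,U21],U12), ([4,1,5,2,3],[U11,U12,U11,U21,U11],U22),
    ([4,2,3,5,1],[U12,U11,U11,U21,U11],U22), ([2,1,5,4,3],[U11,U12,U11,U11,U21],U11),
    ([3,1,5,4,2],[U11,U11,U12,U11,U21],U11)]"

definition table_6 :: evaluation_table where
  "table_6 = [
    ([3,1,6,4,5,2],[U12,U12,U21,U11,U11,U21],U22), ([5,1,2,6,4,3],[U11,U12,U12,U11,U21,U21],U22),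
    ([5,1,6,2,4,3],[U12,U11,U12,U11,U21,U21],U22), ([5,1,6,3,4,2],[U12,U12,U11,U11,U21,U21],U22),
    ([6,1,2,4,5,3],[U11,U11,U12,U11,U11,U21],U22), ([6,1,3,4,5,2],[U11,U12,U11,U11,U11,U21],U22),
    ([6,2,3,4,5,1],[U12,U11,U11,U11,U11,U21],U22), ([6,3,1,2,4,5],[U11,U11,U12,U11,U11,U11],U12),
    ([6,4,1,2,3,5],[U11,U11,U11,U12,U11,U11],U12), ([6,5,1,2,3,4],[U11,U11,U11,U11,U12,U11],U12),
    ([2,1,6,4,5,3],[U11,U12,U12,U11,U11,U21],U12), ([3,2,6,1,4,5],[U12,U11,U21,U11,U11,U11],U22),
    ([5,1,2,3,6,4],[U11,U11,U11,U12,U21,U11],U22), ([6,1,2,3,5,4],[U11,U11,U11,U12,U11,U21],U22),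
    ([6,2,1,3,4,5],[U11,U12,U11,U11,U11,U11],U12), ([2,1,6,4,3,5],[U11,U12,U11,U21,U11,U11],U11),
    ([2,1,6,5,3,4],[U11,U12,U11,U11,U21,U11],U11), ([4,1,2,6,5,3],[U12,U21,U12,U11,U11,U21],U22),
    ([4,2,3,6,1,5],[U12,U11,U11,U21,U11,U11],U22), ([5,1,2,4,6,3],[U11,U11,U12,U11,U21,U21],U21),
    ([6,1,2,3,4,5],[U11,U11,U11,U11,U11,U12],U12), ([4,1,6,5,2,3],[U12,U11,U11,U21,U21,U11],U21),
    ([5,1,2,6,3,4],[U11,U11,U12,U11,U21,U11],U22), ([5,2,3,4,6,1],[U12,U11,U11,U11,U21,U11],U22),
    ([4,1,5,2,6,3],[U12,U11,U12,U21,U21,U11],U22), ([4,1,6,2,3,5],[U12,U11,U11,U21,U12,U21],U22),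
    ([4,1,6,2,5,3],[U12,U11,U12,U11,U11,U21],U12), ([5,1,3,4,6,2],[U11,U12,U11,U11,U21,U21],U21),
    ([5,1,6,2,3,4],[U12,U11,U11,U11,U21,U21],U21), ([2,1,6,3,4,5],[U11,U12,U11,U11,U12,U21],U12),
    ([3,1,2,6,4,5],[U12,U21,U11,U21,U11,U11],U21), ([4,1,3,6,2,5],[U11,U12,U11,U21,U11,U11],U22),
    ([4,1,5,3,6,2],[U11,U12,U12,U21,U11,U21],U22), ([4,1,6,3,5,2],[U12,U11,U11,U21,U11,U21],U21),
    ([2,1,5,3,6,4],[U11,U12,U11,U12,U21,U11],U12), ([2,1,6,3,5,4],[U11,U12,U11,U11,U11,U21],U11),
    ([3,1,6,4,2,5],[U11,U11,U12,U21,U11,U11],U11), ([4,1,2,3,6,5],[U11,U11,U12,U21,U11,U21],U21),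
    ([4,1,2,6,3,5],[U11,U11,U12,U21,U11,U11],U22), ([4,1,3,2,6,5],[U11,U12,U11,U21,U21,U11],U21),
    ([2,1,4,3,6,5],[U11,U12,U21,U11,U12,U21],U11), ([2,1,5,4,6,3],[U11,U12,U11,U11,U21,U12],U12),
    ([3,1,2,6,5,4],[U12,U21,U11,U12,U11,U21],U22), ([3,1,6,2,4,5],[U11,U11,U12,U11,U12,U21],U12),
    ([3,2,4,1,6,5],[U12,U21,U11,U11,U12,U21],U22), ([3,1,4,2,6,5],[U11,U12,U21,U11,U21,U11],U21),
    ([3,1,5,4,6,2],[U11,U12,U12,U11,U21,U11],U12), ([3,1,6,2,5,4],[U11,U12,U21,U11,U11,U11],U22),
    ([3,1,6,5,2,4],[U11,U11,U12,U11,U21,U11],U11), ([3,1,5,2,6,4],[U11,U11,U12,U11,U21,U12],U12)]"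

definition table_7 :: evaluation_table where
  "table_7 = [
    ([2,1,7,5,3,4,6],[U11,U12,U11,U11,U21,U11,U11],U11), ([3,1,6,2,7,5,4],[U12,U12,U21,U12,U11,U21,U21],U11),
    ([3,1,7,4,5,6,2],[U12,U12,U21,U11,U11,U11,U21],U22), ([4,1,5,2,7,3,6],[U12,U11,U12,U21,U21,U11,U11],U22),
    ([4,1,6,2,7,5,3],[U12,U12,U12,U21,U11,U21,U21],U11), ([4,1,7,2,5,6,3],[U12,U11,U12,U21,U11,U11,U21],U22),
    ([4,1,7,3,5,6,2],[U12,U12,U11,U21,U11,U11,U21],U22), ([5,1,6,2,7,4,3],[U12,U12,U12,U11,U21,U21,U21],U11),
    ([6,1,2,3,7,5,4],[U11,U11,U12,U12,U11,U21,U21],U22), ([6,1,2,7,3,5,4],[U11,U12,U11,U12,U11,U21,U21],U22),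
    ([6,1,2,7,4,5,3],[U11,U12,U12,U11,U11,U21,U21],U22), ([6,1,7,2,3,5,4],[U12,U11,U11,U12,U11,U21,U21],U22),
    ([6,1,7,2,4,5,3],[U12,U11,U12,U11,U11,U21,U21],U22), ([6,1,7,3,4,5,2],[U12,U12,U11,U11,U11,U21,U21],U22),
    ([7,1,2,3,5,6,4],[U11,U11,U11,U12,U11,U11,U21],U22), ([7,1,2,4,5,6,3],[U11,U11,U12,U11,U11,U11,U21],U22),
    ([7,1,3,4,5,6,2],[U11,U12,U11,U11,U11,U11,U21],U22), ([7,2,3,4,5,6,1],[U12,U11,U11,U11,U11,U11,U21],U22),
    ([7,3,1,2,4,5,6],[U11,U11,U12,U11,U11,U11,U11],U12), ([7,4,1,2,3,5,6],[U11,U11,U11,U12,U11,U11,U11],U12),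
    ([7,5,1,2,3,4,6],[U11,U11,U11,U11,U12,U11,U11],U12), ([7,6,1,2,3,4,5],[U11,U11,U11,U11,U11,U12,U11],U12),
    ([2,1,6,3,7,5,4],[U11,U12,U12,U12,U11,U21,U21],U12), ([2,1,7,3,5,6,4],[U11,U12,U11,U12,U11,U11,U21],U12),
    ([2,1,7,4,5,6,3],[U11,U12,U12,U11,U11,U11,U21],U12), ([3,2,7,1,4,5,6],[U12,U11,U21,U11,U11,U11,U11],U22),
    ([4,2,3,7,1,5,6],[U12,U11,U11,U21,U11,U11,U11],U22), ([6,1,2,3,4,7,5],[U11,U11,U11,U11,U12,U21,U11],U22),
    ([7,1,2,3,4,6,5],[U11,U11,U11,U11,U12,U11,U21],U22), ([7,2,1,3,4,5,6],[U11,U12,U11,U11,U11,U11,U11],U12),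
    ([2,1,7,4,3,5,6],[U11,U12,U11,U21,U11,U11,U11],U11), ([2,1,7,6,3,4,5],[U11,U12,U11,U11,U11,U21,U11],U11),
    ([5,2,3,4,7,1,6],[U12,U11,U11,U11,U21,U11,U11],U22), ([6,1,2,3,5,7,4],[U11,U11,U11,U12,U11,U21,U21],U21),
    ([7,1,2,3,4,5,6],[U11,U11,U11,U11,U11,U11,U12],U12), ([4,1,7,5,2,3,6],[U12,U11,U11,U21,U21,U11,U11],U21),
    ([5,1,7,6,2,3,4],[U12,U11,U11,U11,U21,U21,U11],U21), ([6,1,2,3,7,4,5],[U11,U11,U11,U12,U11,U21,U11],U22),
    ([6,2,3,4,5,7,1],[U12,U11,U11,U11,U11,U21,U11],U22), ([3,1,4,2,7,5,6],[U12,U11,U21,U21,U12,U11,U11],U22),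
    ([3,1,5,2,7,4,6],[U12,U11,U21,U12,U21,U11,U11],U22), ([5,1,6,2,3,7,4],[U12,U11,U11,U12,U21,U21,U11],U22),
    ([5,1,7,2,3,4,6],[U12,U11,U11,U11,U21,U12,U21],U22), ([5,1,7,2,3,6,4],[U12,U11,U11,U12,U21,U11,U21],U22),
    ([6,1,2,4,5,7,3],[U11,U11,U12,U11,U11,U21,U21],U21), ([6,1,7,2,3,4,5],[U12,U11,U11,U11,U11,U21,U21],U21),
    ([5,1,6,2,4,7,3],[U12,U11,U12,U11,U21,U21,U21],U21), ([5,1,6,3,4,7,2],[U12,U12,U11,U11,U21,U21,U11],U22),
    ([5,1,7,2,4,6,3],[U12,U11,U12,U11,U21,U11,U21],U22), ([6,1,2,7,3,4,5],[U11,U11,U12,U11,U11,U21,U11],U22),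
    ([6,1,3,4,5,7,2],[U11,U12,U11,U11,U11,U21,U11],U22), ([2,1,7,3,4,5,6],[U11,U12,U11,U11,U11,U12,U21],U12),
    ([5,1,2,7,3,4,6],[U11,U12,U11,U11,U21,U12,U21],U22), ([5,1,2,7,4,6,3],[U11,U12,U12,U11,U21,U11,U21],U22),
    ([5,1,3,4,7,2,6],[U11,U12,U11,U11,U21,U11,U11],U22), ([5,1,6,2,7,3,4],[U12,U11,U11,U11,U21,U21,U12],U22),
    ([5,1,7,3,4,6,2],[U12,U11,U11,U11,U21,U11,U21],U21), ([2,1,6,3,4,7,5],[U11,U12,U11,U11,U12,U21,U11],U12),
    ([2,1,7,3,4,6,5],[U11,U12,U11,U11,U11,U11,U21],U11), ([4,1,2,7,5,6,3],[U12,U11,U12,U11,U11,U11,U21],U12),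
    ([5,1,2,3,7,4,6],[U11,U11,U11,U12,U21,U11,U11],U22), ([5,1,2,6,4,7,3],[U11,U12,U12,U11,U21,U21,U11],U22),
    ([5,1,2,7,6,3,4],[U11,U12,U11,U11,U21,U21,U11],U21), ([5,1,2,4,3,7,6],[U11,U11,U12,U11,U21,U12,U21],U22),
    ([5,1,2,6,3,7,4],[U11,U11,U12,U12,U21,U21,U21],U21), ([5,1,2,7,3,6,4],[U11,U12,U11,U11,U21,U11,U21],U21),
    ([3,1,2,7,5,6,4],[U12,U21,U11,U12,U11,U11,U21],U22), ([5,1,2,3,7,6,4],[U11,U11,U12,U11,U21,U11,U21],U21),
    ([5,1,2,4,7,3,6],[U11,U11,U12,U11,U21,U11,U11],U22), ([3,1,7,2,5,6,4],[U11,U11,U12,U12,U11,U11,U21],U12),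
    ([3,1,7,4,2,5,6],[U12,U11,U21,U21,U11,U11,U11],U21), ([5,1,2,3,4,7,6],[U11,U11,U11,U11,U12,U11,U21],U11),
    ([4,1,7,2,3,5,6],[U12,U11,U11,U21,U11,U12,U21],U22), ([4,1,7,6,2,3,5],[U12,U11,U11,U21,U11,U21,U11],U21),
    ([4,1,6,2,3,7,5],[U12,U11,U11,U21,U12,U21,U11],U22), ([4,1,6,3,5,7,2],[U12,U12,U11,U21,U11,U21,U11],U22),
    ([4,1,7,2,3,6,5],[U12,U11,U11,U21,U11,U11,U21],U21), ([4,1,2,7,5,3,6],[U11,U12,U11,U21,U21,U11,U11],U21),
    ([4,1,3,7,2,5,6],[U11,U12,U11,U21,U11,U11,U11],U22), ([4,1,5,3,2,7,6],[U12,U12,U11,U21,U21,U12,U21],U11),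
    ([4,1,5,3,7,2,6],[U12,U12,U11,U21,U21,U11,U11],U22), ([4,1,6,2,5,7,3],[U12,U11,U12,U21,U11,U21,U21],U21),
    ([4,1,6,2,7,3,5],[U12,U12,U11,U21,U11,U21,U21],U21), ([2,1,4,3,7,5,6],[U11,U12,U11,U21,U12,U11,U11],U12),
    ([2,1,5,3,7,4,6],[U11,U12,U11,U12,U21,U11,U11],U12), ([2,1,6,3,5,7,4],[U11,U12,U11,U12,U11,U21,U21],U11),
    ([3,1,2,7,5,4,6],[U12,U21,U11,U11,U21,U11,U11],U21), ([4,1,2,3,7,5,6],[U11,U11,U11,U12,U21,U11,U11],U11),
    ([4,1,5,2,3,7,6],[U12,U11,U11,U21,U21,U12,U21],U21), ([4,1,5,2,7,6,3],[U11,U12,U12,U21,U11,U11,U21],U22),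
    ([2,1,6,3,7,4,5],[U11,U12,U11,U12,U11,U21,U11],U12), ([3,1,7,5,2,4,6],[U11,U11,U12,U11,U21,U11,U11],U11),
    ([4,1,2,7,3,5,6],[U11,U11,U11,U12,U11,U12,U21],U12), ([2,1,6,4,5,7,3],[U11,U12,U11,U11,U11,U21,U12],U12),
    ([3,1,2,7,4,5,6],[U12,U21,U11,U11,U11,U12,U21],U22), ([3,1,7,2,4,5,6],[U12,U11,U21,U11,U11,U12,U21],U22),
    ([4,1,2,6,5,7,3],[U11,U12,U12,U21,U11,U21,U11],U22), ([4,1,2,7,3,6,5],[U11,U11,U12,U21,U11,U11,U11],U22),
    ([4,1,3,5,2,7,6],[U11,U12,U11,U21,U11,U12,U21],U22), ([2,1,4,3,7,6,5],[U12,U11,U12,U21,U12,U11,U21],U12),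
    ([2,1,5,3,4,7,6],[U11,U12,U21,U11,U11,U21,U12],U11), ([2,1,5,3,7,6,4],[U11,U12,U21,U21,U11,U11,U12],U11),
    ([2,1,5,4,7,3,6],[U12,U11,U12,U11,U21,U11,U11],U12), ([3,1,2,6,5,7,4],[U12,U21,U11,U12,U11,U21,U11],U22),
    ([3,1,2,7,4,6,5],[U11,U11,U12,U21,U11,U11,U11],U11), ([3,1,6,4,5,7,2],[U11,U12,U12,U11,U11,U21,U11],U12),
    ([3,1,7,2,4,6,5],[U11,U12,U21,U11,U11,U11,U11],U22), ([4,1,2,5,3,7,6],[U11,U11,U11,U12,U21,U12,U21],U11),
    ([4,1,2,6,3,7,5],[U11,U11,U11,U12,U11,U21,U12],U12), ([4,1,2,7,6,3,5],[U11,U12,U11,U21,U11,U11,U21],U21),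
    ([2,1,5,4,3,7,6],[U12,U11,U12,U11,U21,U11,U21],U11), ([3,1,2,5,4,7,6],[U11,U12,U21,U12,U21,U12,U11],U12),
    ([3,1,2,6,4,7,5],[U11,U11,U12,U21,U12,U11,U11],U12), ([3,1,2,7,6,4,5],[U11,U12,U21,U11,U11,U11,U12],U12),
    ([3,1,5,2,4,7,6],[U11,U12,U21,U11,U11,U12,U21],U22), ([3,1,5,4,2,7,6],[U12,U12,U11,U11,U21,U12,U21],U12),
    ([3,1,5,4,7,2,6],[U11,U12,U12,U11,U21,U11,U11],U12), ([3,1,6,2,4,7,5],[U11,U12,U21,U11,U21,U11,U11],U21),
    ([3,1,6,2,7,4,5],[U11,U12,U12,U11,U11,U21,U21],U11), ([3,2,1,5,4,7,6],[U11,U12,U11,U12,U21,U11,U21],U11),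
    ([4,1,2,3,7,6,5],[U11,U11,U11,U12,U11,U11,U21],U11), ([3,1,4,2,7,6,5],[U11,U11,U12,U21,U11,U11,U12],U12),
    ([3,1,5,2,7,6,4],[U11,U11,U12,U12,U21,U11,U21],U11), ([3,1,6,2,5,7,4],[U11,U11,U12,U11,U11,U21,U12],U12),
    ([3,1,7,6,2,4,5],[U11,U11,U12,U11,U11,U11,U21],U11)]"

definition table :: "nat \<Rightarrow> evaluation_table" where
  "table n = [table_0, table_1, table_2, table_3, table_4, table_5, table_6, table_7] ! n"

text \<open>
  Every word obtained by appending a letter \<open>x \<le> n\<close> to a member of the last list, after making room for \<open>x\<close>,
  is in \<open>W\<close> or contains a pattern.
\<close>

fun covers :: "nat list list \<Rightarrow> nat \<Rightarrow> nat list list \<Rightarrow> nat list list \<Rightarrow> bool" where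
  "covers P n W [] = True"
| "covers P n W (v # vs) =
    (if list_all (\<lambda>x. let w = map (skip x) v @ [x] in if w \<in> set W then True else reducible P w) [1..<Suc n]
     then covers P n W vs else False)"

definition covers_step :: "nat \<Rightarrow> evaluation_table \<Rightarrow> evaluation_table \<Rightarrow> evaluation_table \<Rightarrow> bool" where
  "covers_step n t0 t1 t2 =
    covers patterns n (map fst t2) (map fst t1 @ map (\<lambda>u. u @ [n]) (map fst t0))"

lemma covers_step_tables:
  "covers_step 1 table_0 table_1 table_2" "covers_step 2 table_1 table_2 table_3"
  "covers_step 3 table_2 table_3 table_4" "covers_step 4 table_3 table_4 table_5"
  "covers_step 5 table_4 table_5 table_6"
  by code_simp+

lemma covers_step_table_7: "covers_step 6 table_5 table_6 table_7"
  by code_simp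

definition valid_table :: "evaluation_table \<Rightarrow> bool" where
  "valid_table t = (if distinct (map fst t) then triangular (map (\<lambda>(w, x). (blocks w, x)) t) else False)"

lemma valid_tables:
  "valid_table table_0" "valid_table table_1" "valid_table table_2" "valid_table table_3"
  "valid_table table_4" "valid_table table_5" "valid_table table_6"
  by code_simp+

lemma valid_table_7: "valid_table table_7"
  by code_simp

lemma valid_table: "n \<le> 7 \<Longrightarrow> valid_table (table n)"
  using valid_tables valid_table_7
  by (auto simp: table_def nth_Cons' le_Suc_eq numeral_eq_Suc)

lemma covers_step_table:
  assumes "1 \<le> n" "n \<le> 6" shows "covers_step n (table (n - 1)) (table n) (table (Suc n))"
proof -
  consider "n = 1" | "n = 2" | "n = 3" | "n = 4" | "n = 5" | "n = 6" using assms by linarith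
  then show ?thesis
    by cases (simp_all add: table_def covers_step_tables[simplified] covers_step_table_7)
qed

lemma covers_sound:
  "covers P n W vs \<Longrightarrow> v \<in> set vs \<Longrightarrow> x \<in> {1..n} \<Longrightarrow>
    map (skip x) v @ [x] \<in> set W \<or> reducible P (map (skip x) v @ [x])"
  by (induction vs) (auto simp: list_all_iff Let_def split: if_splits)

lemma proper_normal_words_table:
  "n \<le> 7 \<Longrightarrow> proper_normal_words {1..n} \<subseteq> set (map fst (table n))"
proof (induction n rule: less_induct)
  case (less n)
  consider "n = 0" | "n = 1" | n' where "n = Suc n'" "1 \<le> n'" by (cases n) fastforce+
  then show ?case
  proof cases
    case 1
    then show ?thesis by (auto simp: proper_normal_words_def table_def table_0_def permutations_of_set_def)
  next
    case 2
    have "\<not> proper w" if "set w = {1}" "distinct w" for w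
    proof -
      have "length w = 1" using that distinct_card[of w] by simp
      then obtain a where "w = [a]" by (cases w) auto
      then show ?thesis by (simp add: proper_def Let_def)
    qed
    then show ?thesis using 2 by (auto simp: proper_normal_words_def permutations_of_set_def)
  next
    case 3
    show ?thesis
    proof
      fix w assume w: "w \<in> proper_normal_words {1..n}"
      then obtain v x where v: "w = map (skip x) v @ [x]" "x \<in> {1..n'}"
        "v \<in> proper_normal_words {1..n'} \<or> (\<exists>u\<in>proper_normal_words {1..n' - 1}. v = u @ [n'])"
        using proper_normal_words_step[of w n'] 3 by metis
      have "proper_normal_words {1..n'} \<subseteq> set (map fst (table n'))"
        "proper_normal_words {1..n' - 1} \<subseteq> set (map fst (table (n' - 1)))"
        using 3 less.prems by (intro less.IH; simp)+
      then have "v \<in> set (map fst (table n') @ map (\<lambda>u. u @ [n']) (map fst (table (n' - 1))))"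
        using v(3) by auto
      moreover have "covers_step n' (table (n' - 1)) (table n') (table (Suc n'))"
        using 3 less.prems by (intro covers_step_table) auto
      ultimately have "w \<in> set (map fst (table n)) \<or> reducible patterns w"
        unfolding covers_step_def v(1) 3(1) using v(2) by (intro covers_sound)
      then show "w \<in> set (map fst (table n))"
        using w reducible_imp_not_normal by (auto simp: proper_normal_words_def)
    qed
  qed
qed

section \<open>Linear independence of the normal block products\<close>

definition of_bmat :: "bool m2 \<Rightarrow> 'k::field m2" where
  "of_bmat = map_m2 of_bool"

definition assign :: "matrix_unit list \<Rightarrow> nat \<Rightarrow> 'k::field m2" where
  "assign us i = of_bmat (bmat_unit (us ! (i - 1)))"

abbreviation scalar :: "'k::field \<Rightarrow> 'k m2" where
  "scalar c \<equiv> M2 c 0 0 c"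

lemma entry_of_bmat: "entry r (of_bmat A) = of_bool (entry r A)"
  by (cases A; cases r) (simp_all add: of_bmat_def)

lemma entry_scalar_mult: "entry r (scalar c * A) = c * entry r A"
  by (cases A; cases r) (simp_all add: times_m2_def)

lemma entry_add: "entry r (A + B) = entry r A + entry r (B :: 'k::field m2)"
  by (cases A; cases B; cases r) (simp_all add: plus_m2_def)

lemma entry_0: "entry r (0 :: 'k::field m2) = 0"
  by (cases r) (simp_all add: zero_m2_def)

lemma block_product_map:
  assumes "strict_mono_on (set w) h" shows "block_product y (map h w) = block_product (y \<circ> h) w"
proof -
  have "left_normed y (map h b) = left_normed (y \<circ> h) b" if "b \<in> set (blocks w)" for b
    using block_nonempty[OF that] by (simp add: left_normed_def hd_map map_tl[symmetric])
  then show ?thesis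
    by (simp add: block_product_def blocks_map[OF assms] comp_def cong: map_cong)
qed

lemma block_product_cong:
  assumes "\<And>i. i \<in> set w \<Longrightarrow> y i = y' i" shows "block_product y w = block_product y' w"
proof -
  have "left_normed y b = left_normed y' b" if b: "b \<in> set (blocks w)" for b
  proof -
    obtain m ks where "b = m # ks" using block_nonempty[OF b] by (cases b) auto
    then have "y (hd b) = y' (hd b)" "map y (tl b) = map y' (tl b)"
      using set_block[OF b] assms by auto
    then show ?thesis unfolding left_normed_def by (simp only:)
  qed
  then show ?thesis by (simp add: block_product_def cong: map_cong)
qed

text \<open>
  The letters of \<open>w\<close> that are blocks of their own, and the word that remains when they are erased.
\<close>

definition singles :: "nat list \<Rightarrow> nat set" where
  "singles w = {s. [s] \<in> set (blocks w)}"

definition proper_part :: "nat list \<Rightarrow> nat list" where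
  "proper_part w = concat (filter (\<lambda>b. tl b \<noteq> []) (blocks w))"

lemma singles_subset: "singles w \<subseteq> set w"
  using set_block by (fastforce simp: singles_def)

lemma blocks_proper_part:
  assumes "distinct w" shows "blocks (proper_part w) = filter (\<lambda>b. tl b \<noteq> []) (blocks w)"
  unfolding proper_part_def
proof (rule blocks_concat)
  show "block_form (filter (\<lambda>b. tl b \<noteq> []) (blocks w))"
    using block_form_blocks[OF assms] by (auto simp: block_form_def sorted_wrt_map sorted_wrt_filter)
qed

lemma subseq_proper_part: "subseq (proper_part w) w"
proof -
  have "subseq (concat (filter P bs)) (concat bs)" for P and bs :: "nat list list"
    by (induction bs) (auto intro: list_emb_append_mono subseq_rev_drop_many)
  then show ?thesis unfolding proper_part_def by (metis concat_blocks)
qed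

lemma set_proper_part:
  assumes "distinct w" shows "set (proper_part w) = set w - singles w" and "distinct (proper_part w)"
proof -
  show "distinct (proper_part w)"
    using assms subseq_proper_part[of w] subseq_conv_nths by (metis distinct_nthsI)
  have "distinct (concat (blocks w))" using assms by simp
  then have dis: "b = b'" if "b \<in> set (blocks w)" "b' \<in> set (blocks w)" "s \<in> set b" "s \<in> set b'" for b b' s
    using that unfolding distinct_concat_iff by blast
  have *: "tl b \<noteq> [] \<longleftrightarrow> s \<notin> singles w" if b: "b \<in> set (blocks w)" "s \<in> set b" for b s
  proof
    assume "tl b \<noteq> []"
    then show "s \<notin> singles w" using dis[OF b(1) _ b(2), of "[s]"] by (auto simp: singles_def)
  next
    assume "s \<notin> singles w"
    then show "tl b \<noteq> []" using b by (cases b) (auto simp: singles_def)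
  qed
  have "set w = (\<Union>b\<in>set (blocks w). set b)" by (metis concat_blocks set_concat)
  then show "set (proper_part w) = set w - singles w"
    using * by (auto simp: proper_part_def)
qed

text \<open>
  The blocks of a word are sorted by their first letters, so that the set of blocks determines the word.
\<close>

lemma eq_if_proper_part_eq:
  assumes "distinct v" "distinct w" "proper_part v = proper_part w" "singles v = singles w"
  shows "v = w"
proof -
  have split: "set (blocks u) = set (filter (\<lambda>b. tl b \<noteq> []) (blocks u)) \<union> (\<lambda>s. [s]) ` singles u" for u
  proof -
    have "b \<in> (\<lambda>s. [s]) ` singles u" if b: "b \<in> set (blocks u)" "tl b = []" for b
    proof -
      have "b = [hd b]" using b block_nonempty[OF b(1)] by (metis list.collapse)
      then show ?thesis using b(1) unfolding singles_def by (metis image_eqI mem_Collect_eq)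
    qed
    moreover have "[s] \<in> set (blocks u)" if "s \<in> singles u" for s
      using that by (simp add: singles_def)
    ultimately show ?thesis by auto
  qed
  have eq: "set (blocks v) = set (blocks w)"
    using split[of v] split[of w] blocks_proper_part assms by metis
  have sorted: "sorted (map hd (blocks u)) \<and> distinct (map hd (blocks u))" if "distinct u" for u
    using block_form_blocks[OF that] by (simp add: block_form_def strict_sorted_iff)
  then have "inj_on hd (set (blocks v) \<union> set (blocks w))"
    using eq sorted[OF assms(1)] by (simp add: distinct_map)
  then have "blocks v = blocks w"
    using map_sorted_distinct_set_unique[of hd "blocks v" "blocks w"] sorted assms(1,2) eq by blast
  then show ?thesis by (metis concat_blocks)
qed

lemma left_normed_one:
  assumes "i \<in> set b" "tl b \<noteq> []" "y i = (1 :: 'b::ring_1)" shows "left_normed y b = 0"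
proof -
  have zero: "foldl commutator (0 :: 'b) fs = 0" for fs
    by (induction fs) (simp_all add: commutator_def)
  have tail: "foldl commutator f fs = 0" if "(1 :: 'b) \<in> set fs" for f fs
    using that by (induction fs arbitrary: f) (auto simp: commutator_def zero)
  obtain m k ks where b: "b = m # k # ks"
    using assms(2) by (cases b; cases "tl b") auto
  show ?thesis
  proof (cases "i = m")
    case True
    then show ?thesis using assms(3) by (simp add: left_normed_def b commutator_def zero)
  next
    case False
    then have "1 \<in> set (map y (tl b))" using assms(1,3) b by force
    then show ?thesis using tail by (simp add: left_normed_def)
  qed
qed

lemma block_product_one_eq_0:
  assumes "s \<in> set w" "s \<notin> singles w" "y s = (1 :: 'b::ring_1)" shows "block_product y w = 0"
proof -
  obtain b where b: "b \<in> set (blocks w)" "s \<in> set b"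
    using assms(1) by (metis UN_E concat_blocks set_concat)
  then have "b \<noteq> [s]" using assms(2) by (auto simp: singles_def)
  then have "tl b \<noteq> []" using b(2) by (cases b) auto
  then have "left_normed y b = 0" using left_normed_one b(2) assms(3) by blast
  then have "0 \<in> set (map (left_normed y) (blocks w))" using b(1) by force
  moreover have "prod_list fs = 0" if "0 \<in> set fs" for fs :: "'b list"
    using that by (induction fs) auto
  ultimately show ?thesis unfolding block_product_def by blast
qed

lemma block_product_proper_part:
  assumes "distinct w"
  shows "block_product (\<lambda>i. if i \<in> singles w then 1 else y i) w = (block_product y (proper_part w) :: 'b::ring_1)"
proof -
  let ?y = "\<lambda>i. if i \<in> singles w then 1 else y i"
  have "prod_list (map (left_normed ?y) bs) = prod_list (map (left_normed ?y) (filter (\<lambda>b. tl b \<noteq> []) bs))"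
    if "set bs \<subseteq> set (blocks w)" for bs
    using that
  proof (induction bs)
    case (Cons b bs)
    have "left_normed ?y b = 1" if tl: "tl b = []"
    proof -
      obtain s where "b = [s]" using tl block_nonempty[of b w] Cons.prems by (cases b) auto
      then show ?thesis using Cons.prems by (simp add: left_normed_def singles_def)
    qed
    then show ?case using Cons by auto
  qed simp
  from this[of "blocks w"] have "block_product ?y w = block_product ?y (proper_part w)"
    by (simp add: block_product_def blocks_proper_part[OF assms])
  also have "\<dots> = block_product y (proper_part w)"
    by (rule block_product_cong) (simp add: set_proper_part[OF assms])
  finally show ?thesis .
qed

text \<open>
  The normal words in which each letter of \<open>V\<close> occurs exactly once.
\<close>

definition normal_words :: "nat set \<Rightarrow> nat list set" where
  "normal_words V = {w \<in> permutations_of_set V. normal_word w}"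

lemma finite_normal_words: "finite V \<Longrightarrow> finite (normal_words V)"
  by (simp add: normal_words_def)

context
  assumes char: "CHAR('k::field) = 2"
begin

lemma of_bool_bit_add: "of_bool (bit_add a b) = (of_bool a + of_bool b :: 'k)"
  using two_eq_0_if_CHAR_2[OF char] by (cases a; cases b) (simp_all add: bit_add_def)

lemma of_bool_bit_mult: "of_bool (bit_mult a b) = (of_bool a * of_bool b :: 'k)"
  by (simp add: bit_mult_def)

lemma of_bmat_mult: "of_bmat (bmat_mult A B) = (of_bmat A * of_bmat B :: 'k m2)"
  by (cases A; cases B) (simp add: of_bmat_def times_m2_def of_bool_bit_add of_bool_bit_mult)

lemma of_bmat_commutator: "of_bmat (bmat_commutator A B) = commutator (of_bmat A) (of_bmat B :: 'k m2)"
proof -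
  have "of_bmat (bmat_add A B) = (of_bmat A + of_bmat B :: 'k m2)" for A B
    by (cases A; cases B) (simp add: of_bmat_def plus_m2_def of_bool_bit_add)
  then show ?thesis
    by (simp add: bmat_commutator_def commutator_def minus_char_2[OF m2_double[OF char]] of_bmat_mult)
qed

lemma of_bmat_block_product:
  "of_bmat (bmat_block_product us bs) = (prod_list (map (left_normed (assign us)) bs) :: 'k m2)"
proof (induction bs)
  case Nil
  show ?case by (simp add: of_bmat_def one_m2_def)
next
  case (Cons b bs)
  have "of_bmat (bmat_left_normed us A ks) = foldl commutator (of_bmat A) (map (assign us) ks :: 'k m2 list)"
    for A ks
    by (induction ks arbitrary: A) (simp_all add: of_bmat_commutator assign_def)
  then show ?case
    by (simp add: Cons of_bmat_mult left_normed_def del: One_nat_def flip: assign_def)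
qed

text \<open>
  Comparing the entries at the evaluation point of the first word of the table gives its
  coefficient, and the remaining words form a triangular table again.
\<close>

lemma triangular_independent:
  fixes c :: "nat list \<Rightarrow> 'k"
  assumes "triangular (map (\<lambda>(w, x). (blocks w, x)) t)"
    and "\<And>y. (\<Sum>w\<leftarrow>map fst t. scalar (c w) * block_product y w) = 0"
  shows "\<forall>w\<in>set (map fst t). c w = 0"
  using assms
proof (induction t)
  case (Cons e t)
  obtain w us r where e: "e = (w, us, r)" by (cases e)
  have diag: "entry r (block_product (assign us) w) = (1 :: 'k)"
    and zero: "\<And>v. v \<in> set (map fst t) \<Longrightarrow> entry r (block_product (assign us) v) = (0 :: 'k)"
    and t: "triangular (map (\<lambda>(w, x). (blocks w, x)) t)"
    using Cons.prems(1)
    by (auto simp: e block_product_def list_all_iff entry_of_bmat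
        simp flip: of_bmat_block_product split: if_splits)
  have "entry r (\<Sum>v\<leftarrow>vs. scalar (c v) * block_product (assign us) v) = 0"
    if "set vs \<subseteq> set (map fst t)" for vs
    using that by (induction vs) (simp_all add: entry_0 entry_add entry_scalar_mult zero del: set_map)
  from this[of "map fst t"] have "c w = 0"
    using Cons.prems(2)[of "assign us", THEN arg_cong[where f="entry r"]]
    by (simp add: e entry_add entry_scalar_mult diag entry_0)
  moreover have "\<forall>w\<in>set (map fst t). c w = 0"
  proof (rule Cons.IH[OF t])
    show "(\<Sum>w\<leftarrow>map fst t. scalar (c w) * block_product y w) = 0" for y
      using Cons.prems(2)[of y] calculation by (simp add: e flip: zero_m2_def)
  qed
  ultimately show ?case by (simp add: e)
qed simp

text \<open>
  The tables only treat the variables \<open>1, \<dots>, n\<close>; an increasing enumeration carries the result over to any set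
  of at most seven variables.
\<close>

lemma proper_normal_words_independent:
  fixes c :: "nat list \<Rightarrow> 'k"
  assumes V: "finite V" "card V \<le> 7"
    and sum0: "\<And>y. (\<Sum>w\<in>proper_normal_words V. scalar (c w) * block_product y w) = 0"
    and w: "w \<in> proper_normal_words V"
  shows "c w = 0"
proof -
  define n where "n = card V"
  obtain h0 where h0: "bij_betw h0 {..<n} V" "strict_mono_on {..<n} h0"
    unfolding n_def by (rule ex_bij_betw_strict_mono_card[OF V(1)])
  define h where "h i = h0 (i - 1)" for i
  have "bij_betw (\<lambda>i. i - 1) {1..n} {..<n}"
    by (rule bij_betw_byWitness[where f'=Suc]) auto
  from bij_betw_trans[OF this h0(1)] have "bij_betw h {1..n} V"
    by (simp add: h_def[abs_def] comp_def)
  moreover have "strict_mono_on {1..n} h"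
  proof (rule strict_mono_onI)
    fix i j assume "i \<in> {1..n}" "j \<in> {1..n}" "i < j"
    then have "i - 1 \<in> {..<n}" "j - 1 \<in> {..<n}" "i - 1 < j - 1" by auto
    then show "h i < h j" unfolding h_def using h0(2) strict_mono_onD by blast
  qed
  ultimately have h: "bij_betw h {1..n} V" "strict_mono_on {1..n} h" .
  define g where "g = inv_into {1..n} h"
  have gh: "g (h i) = i" if "i \<in> {1..n}" for i
    using that h(1) by (simp add: g_def bij_betw_inv_into_left)
  define P where "P = proper_normal_words {1..n}"
  define Q where "Q = {u \<in> P. map h u \<in> proper_normal_words V}"
  define ws where "ws = map fst (table n)"
  define c' where "c' u = (if u \<in> Q then c (map h u) else 0)" for u
  have P: "set u = {1..n}" if "u \<in> P" for u
    using that by (simp add: P_def proper_normal_words_def permutations_of_set_def)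
  have "P \<subseteq> set ws"
    using proper_normal_words_table[of n] V(2) unfolding P_def ws_def n_def by simp
  then have Q_ws: "Q \<subseteq> set ws" by (auto simp: Q_def)
  have lift: "\<exists>u\<in>Q. map h u = v" if v: "v \<in> proper_normal_words V" for v
  proof -
    have v': "set v = V" "distinct v" "proper v" "normal_word v"
      using v by (simp_all add: proper_normal_words_def permutations_of_set_def)
    define u where "u = map g v"
    have hu: "map h u = v"
      using v'(1) h(1) by (auto simp: u_def g_def bij_betw_inv_into_right intro!: map_idI)
    have set_u: "set u = {1..n}"
      using v'(1) h(1) bij_betw_inv_into[OF h(1)] by (simp add: u_def g_def bij_betw_def)
    have mono: "strict_mono_on (set u) h" using h(2) set_u by simp
    have "distinct u" using v'(2) hu by (metis distinct_map)
    moreover have "proper u" using v'(3) hu proper_map[OF mono] by simp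
    moreover have "normal_word u" using v'(4) hu normal_word_map mono by metis
    ultimately have "u \<in> P"
      using set_u by (simp add: P_def proper_normal_words_def permutations_of_set_def)
    then show ?thesis using hu v by (auto simp: Q_def)
  qed
  have inj: "inj_on (map h) Q"
  proof (rule inj_onI)
    fix u v assume uv: "u \<in> Q" "v \<in> Q" "map h u = map h v"
    then have "inj_on h (set u \<union> set v)" using P h(1) by (simp add: Q_def bij_betw_def)
    then show "u = v" using uv(3) by (simp add: inj_on_map_eq_map)
  qed
  have image: "map h ` Q = proper_normal_words V"
    using lift by (auto simp: Q_def)
  have "(\<Sum>u\<leftarrow>ws. scalar (c' u) * block_product y u) = 0" for y
  proof -
    have E: "block_product (y \<circ> g) (map h u) = block_product y u" if "u \<in> Q" for u
    proof -
      have u: "set u = {1..n}" using that P by (simp add: Q_def)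
      then have "block_product (y \<circ> g) (map h u) = block_product (y \<circ> g \<circ> h) u"
        using h(2) by (intro block_product_map) simp
      also have "\<dots> = block_product y u" using u gh by (intro block_product_cong) simp
      finally show ?thesis .
    qed
    have "distinct ws"
      using valid_table[of n] V(2) by (simp add: ws_def n_def valid_table_def split: if_splits)
    then have "(\<Sum>u\<leftarrow>ws. scalar (c' u) * block_product y u) =
        (\<Sum>u\<in>set ws. scalar (c' u) * block_product y u)"
      by (rule sum_list_distinct_conv_sum_set)
    also have "\<dots> = (\<Sum>u\<in>Q. scalar (c' u) * block_product y u)"
      using Q_ws by (intro sum.mono_neutral_right) (auto simp: c'_def simp flip: zero_m2_def)
    also have "\<dots> = (\<Sum>u\<in>Q. scalar (c (map h u)) * block_product (y \<circ> g) (map h u))"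
      by (intro sum.cong) (simp_all add: c'_def E)
    also have "\<dots> = (\<Sum>v\<in>map h ` Q. scalar (c v) * block_product (y \<circ> g) v)"
      by (simp add: sum.reindex[OF inj])
    finally show ?thesis using sum0 image by simp
  qed
  moreover have "triangular (map (\<lambda>(w, x). (blocks w, x)) (table n))"
    using valid_table[of n] V(2) by (simp add: n_def valid_table_def split: if_splits)
  ultimately have "\<forall>u\<in>set ws. c' u = 0"
    unfolding ws_def by (intro triangular_independent) simp_all
  moreover obtain u where "u \<in> Q" "map h u = w" using lift[OF w] by blast
  ultimately show ?thesis using Q_ws by (auto simp: c'_def split: if_splits)
qed

text \<open>
  Take a word \<open>w\<^sub>0\<close> with nonzero coefficient and as many single blocks as possible, and substitute
  1 for the letters of these blocks. Only the words with the same single letters survive,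
  and their block products become those of their proper parts.
\<close>

lemma normal_words_independent:
  fixes c :: "nat list \<Rightarrow> 'k"
  assumes V: "finite V" "card V \<le> 7"
    and sum0: "\<And>y. (\<Sum>w\<in>normal_words V. scalar (c w) * block_product y w) = 0"
    and w: "w \<in> normal_words V"
  shows "c w = 0"
proof (rule ccontr)
  assume "c w \<noteq> 0"
  define N where "N = {v \<in> normal_words V. c v \<noteq> 0}"
  have words: "set v = V" "distinct v" "normal_word v" if "v \<in> normal_words V" for v
    using that by (simp_all add: normal_words_def permutations_of_set_def)
  have "finite N" "N \<noteq> {}"
    using w \<open>c w \<noteq> 0\<close> finite_normal_words[OF V(1)] by (auto simp: N_def)
  then have "Max ((\<lambda>v. card (singles v)) ` N) \<in> (\<lambda>v. card (singles v)) ` N"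
    by (intro Max_in) auto
  then obtain w\<^sub>0 where w\<^sub>0: "w\<^sub>0 \<in> N" "card (singles w\<^sub>0) = Max ((\<lambda>v. card (singles v)) ` N)"
    by auto
  then have max_singles: "card (singles v) \<le> card (singles w\<^sub>0)" if "v \<in> N" for v
    using that \<open>finite N\<close> by simp
  define S where "S = singles w\<^sub>0"
  define W where "W = {v \<in> N. singles v = S}"
  have max: "\<not> S \<subseteq> singles v" if v: "v \<in> N" "singles v \<noteq> S" for v
  proof
    assume "S \<subseteq> singles v"
    moreover have "finite (singles v)" using finite_subset[OF singles_subset] by blast
    ultimately have "card S < card (singles v)" using v(2) by (metis psubsetI psubset_card_mono)
    then show False
      using max_singles[OF v(1)] by (simp add: S_def)
  qed
  have S: "S \<subseteq> V" using singles_subset words w\<^sub>0 by (fastforce simp: S_def N_def)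
  have inj: "inj_on proper_part W"
    using eq_if_proper_part_eq words(2) by (intro inj_onI) (auto simp: W_def N_def)
  have image: "proper_part ` W \<subseteq> proper_normal_words (V - S)"
  proof
    fix u assume "u \<in> proper_part ` W"
    then obtain v where v: "v \<in> normal_words V" "singles v = S" "u = proper_part v"
      by (auto simp: W_def N_def)
    then show "u \<in> proper_normal_words (V - S)"
      using words[OF v(1)] set_proper_part[of v] subseq_proper_part[of v]
      by (auto simp: proper_normal_words_def permutations_of_set_def proper_def blocks_proper_part
          intro: normal_word_subseq)
  qed
  define c' where "c' u = (if u \<in> proper_part ` W then c (inv_into W proper_part u) else 0)" for u
  have fin: "finite (V - S)" "finite (proper_normal_words (V - S))"
    using V(1) by (simp_all add: proper_normal_words_def)
  have "(\<Sum>u\<in>proper_normal_words (V - S). scalar (c' u) * block_product y u) = 0" for y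
  proof -
    define y' where "y' i = (if i \<in> S then 1 else y i)" for i
    have "(\<Sum>u\<in>proper_normal_words (V - S). scalar (c' u) * block_product y u) =
        (\<Sum>u\<in>proper_part ` W. scalar (c' u) * block_product y u)"
      using image fin by (intro sum.mono_neutral_right) (auto simp: c'_def simp flip: zero_m2_def)
    also have "\<dots> = (\<Sum>v\<in>W. scalar (c v) * block_product y (proper_part v))"
      using inj by (simp add: sum.reindex c'_def)
    also have "\<dots> = (\<Sum>v\<in>W. scalar (c v) * block_product y' v)"
    proof (rule sum.cong)
      fix v assume "v \<in> W"
      then have "distinct v" "singles v = S" using words(2) by (auto simp: W_def N_def)
      then show "scalar (c v) * block_product y (proper_part v) = scalar (c v) * block_product y' v"
        using block_product_proper_part[of v y] by (simp add: y'_def[abs_def])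
    qed simp
    also have "\<dots> = (\<Sum>v\<in>normal_words V. scalar (c v) * block_product y' v)"
    proof (rule sum.mono_neutral_left)
      show "\<forall>v\<in>normal_words V - W. scalar (c v) * block_product y' v = 0"
      proof
        fix v assume v: "v \<in> normal_words V - W"
        show "scalar (c v) * block_product y' v = 0"
        proof (cases "c v = 0")
          case True
          then show ?thesis by (simp flip: zero_m2_def)
        next
          case False
          then have "v \<in> N" "singles v \<noteq> S" using v by (auto simp: N_def W_def)
          then obtain s where "s \<in> S" "s \<notin> singles v" using max by blast
          then have "block_product y' v = 0"
            using S words(1)[of v] v by (intro block_product_one_eq_0[of s]) (auto simp: y'_def)
          then show ?thesis by simp
        qed
      qed
    qed (use finite_normal_words[OF V(1)] in \<open>auto simp: W_def N_def\<close>)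
    finally show ?thesis using sum0 by simp
  qed
  moreover have "card (V - S) \<le> 7" using V card_mono[of V "V - S"] by simp
  moreover have "w\<^sub>0 \<in> W" using w\<^sub>0 by (simp add: W_def S_def)
  ultimately have "c' (proper_part w\<^sub>0) = 0"
    using image fin by (intro proper_normal_words_independent[of "V - S"]) auto
  then have "c w\<^sub>0 = 0" using \<open>w\<^sub>0 \<in> W\<close> inj by (simp add: c'_def)
  then show False using w\<^sub>0 by (simp add: N_def)
qed

theorem multilinear_identity_consequence:
  fixes f :: "'k free_algebra"
  assumes "multilinear n f" "n \<le> 7" "identity_of_M2 f"
  shows "consequence f {st4, S5, T5}"
proof -
  define I where "I = T_ideal hull {st4, S5, T5 :: 'k free_algebra}"
  have I: "T_ideal I" unfolding I_def by (rule T_ideal_hull)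
  have gens: "st4 \<in> I" "S5 \<in> I" "T5 \<in> I"
    unfolding I_def using hull_subset[of "{st4, S5, T5}"] by auto
  have I_identities: "I \<subseteq> {g. identity_of_M2 g}"
    unfolding I_def using identity_of_M2_st4[OF char] identity_of_M2_S5[OF char] identity_of_M2_T5[OF char]
    by (intro hull_minimal T_ideal_identity_of_M2) simp
  obtain V where V: "finite V" "card V = n" "Poly_Mapping.keys f \<subseteq> permutations_of_set V"
    using assms(1) unfolding multilinear_def by blast
  define N where "N = normal_words V"
  have "finite N" unfolding N_def by (rule finite_normal_words[OF V(1)])
  define comb :: "(nat list \<Rightarrow> 'k) \<Rightarrow> 'k free_algebra" where
    "comb c = (\<Sum>w\<in>N. scal (c w) * block_product X w)" for c
  \<comment> \<open>The multilinear elements spanned by block products modulo \<open>I\<close>, together with \<open>I\<close> itself.\<close>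
  define U where "U = {g. \<exists>c. g - comb c \<in> I}"
  have "comb (\<lambda>_. 0) = 0" by (simp add: comb_def scal_0)
  then have "I \<subseteq> U" unfolding U_def by (auto intro!: exI[of _ "\<lambda>_. 0"])
  have add: "g + g' \<in> U" if g: "g \<in> U" "g' \<in> U" for g g'
  proof -
    obtain c c' where c: "g - comb c \<in> I" "g' - comb c' \<in> I" using g by (auto simp: U_def)
    have "comb (\<lambda>w. c w + c' w) = comb c + comb c'"
      by (simp add: comb_def scal_add distrib_right sum.distrib)
    then have "g + g' - comb (\<lambda>w. c w + c' w) = (g - comb c) + (g' - comb c')" by simp
    then show ?thesis using T_ideal_add[OF I c] unfolding U_def mem_Collect_eq by metis
  qed
  have scale: "scal a * g \<in> U" if g: "g \<in> U" for a g
  proof -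
    obtain c where c: "g - comb c \<in> I" using g by (auto simp: U_def)
    have "comb (\<lambda>w. a * c w) = scal a * comb c"
      by (simp add: comb_def scal_mult sum_distrib_left mult.assoc)
    then have "scal a * g - comb (\<lambda>w. a * c w) = scal a * (g - comb c)"
      by (simp add: right_diff_distrib)
    then show ?thesis using T_ideal_mult_left[OF I c, of "scal a"] unfolding U_def mem_Collect_eq by metis
  qed
  have "block_product X v \<in> U" if v: "v \<in> permutations_of_set V" "normal_word v" for v
  proof -
    have "comb (\<lambda>w. if w = v then 1 else 0) = (\<Sum>w\<in>N. if w = v then block_product X w else 0)"
      unfolding comb_def by (intro sum.cong) (simp_all add: scal_0 scal_1)
    also have "\<dots> = block_product X v"
      using v \<open>finite N\<close> by (simp add: N_def normal_words_def)
    finally show ?thesis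
      using T_ideal_0[OF I] unfolding U_def by (auto intro!: exI[of _ "\<lambda>w. if w = v then 1 else 0"])
  qed
  then have mon_U: "mon w \<in> U" if "w \<in> permutations_of_set V" for w
    using words_spanned_by_block_products[OF char I gens V(1) that, of U] add \<open>I \<subseteq> U\<close> by blast
  have "(\<Sum>w\<in>A. scal (Poly_Mapping.lookup f w) * mon w) \<in> U"
    if "finite A" "A \<subseteq> permutations_of_set V" for A
    using that
  proof (induction A)
    case empty
    show ?case using \<open>I \<subseteq> U\<close> T_ideal_0[OF I] by auto
  qed (use add scale mon_U in auto)
  then have "f \<in> U" using V(3) by (subst free_algebra_expand) auto
  then obtain c where c: "f - comb c \<in> I" unfolding U_def by blast
  have "(\<Sum>w\<in>N. scalar (c w) * block_product y w) = 0" for y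
  proof -
    have "mat2.evalp y (f - comb c) = 0" "mat2.evalp y f = 0"
      using c I_identities assms(3) by (auto simp: identity_of_M2_iff)
    then have "mat2.evalp y (comb c) = 0" by (simp add: mat2.evalp_diff)
    then show ?thesis
      by (simp add: comb_def mat2.evalp_sum mat2.evalp_mult mat2.evalp_scal mat2.evalp_block_product)
  qed
  then have "c w = 0" if "w \<in> N" for w
    using normal_words_independent[OF V(1), of c w] V(2) assms(2) that unfolding N_def by blast
  then have "comb c = 0" by (simp add: comb_def scal_0)
  then show ?thesis using c by (simp add: consequence_def I_def)
qed

end

section \<open>None of the three identities follows from the other two\<close>

lemma mult_scal_left: "f * (scal c * g) = scal c * (f * g)"
  by (simp add: scal_commute[of c f] flip: mult.assoc)

text \<open>
  The linear functional that adds the coefficients at the words in \<open>L\<close>.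
\<close>

definition coeff_sum :: "nat list list \<Rightarrow> 'k::field free_algebra \<Rightarrow> 'k" where
  "coeff_sum L f = (\<Sum>w\<in>set L. Poly_Mapping.lookup f w)"

lemma coeff_sum_add: "coeff_sum L (f + g) = coeff_sum L f + coeff_sum L g"
  by (simp add: coeff_sum_def lookup_add sum.distrib)

lemma coeff_sum_0: "coeff_sum L 0 = 0"
  by (simp add: coeff_sum_def)

lemma coeff_sum_mon: "coeff_sum L (mon w) = (if w \<in> set L then 1 else 0)"
  by (simp add: coeff_sum_def mon_def lookup_single when_def)

lemma coeff_sum_scal: "coeff_sum L (scal c * f) = c * coeff_sum L f"
proof (induction f rule: free_algebra_induct)
  case (monomial d w)
  have "scal c * (scal d * mon w) = Poly_Mapping.single w (c * d)"
    by (metis scal_mult mult.assoc scal_times_mon)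
  then show ?case
    by (simp only: scal_times_mon) (simp add: coeff_sum_def lookup_single when_def)
qed (simp add: distrib_left coeff_sum_add)

lemma coeff_sum_sum_list_mon:
  "coeff_sum L (sum_list (map mon R) :: 'k::field free_algebra) = of_nat (length (filter (\<lambda>r. r \<in> set L) R))"
  by (induction R) (simp_all add: coeff_sum_0 coeff_sum_add coeff_sum_mon)

text \<open>
  The elements all of whose consequences are annihilated by this functional; the largest T-ideal
  contained in its kernel.
\<close>

definition annihilated :: "nat list list \<Rightarrow> 'k::field free_algebra set" where
  "annihilated L = {f. \<forall>\<phi> g h. algebra_endomorphism \<phi> \<longrightarrow> coeff_sum L (g * \<phi> f * h) = 0}"

lemma algebra_endomorphism_0: "algebra_endomorphism \<phi> \<Longrightarrow> g * \<phi> 0 * h = 0"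
  unfolding algebra_endomorphism_def by (metis add_cancel_right_left mult_zero_left mult_zero_right)

lemma T_ideal_annihilated: "T_ideal (annihilated L :: 'k::field free_algebra set)"
  unfolding T_ideal_def two_sided_ideal_def
proof (intro conjI ballI allI impI)
  show "0 \<in> (annihilated L :: 'k free_algebra set)"
    by (auto simp: annihilated_def coeff_sum_0 algebra_endomorphism_0)
next
  fix f g :: "'k free_algebra"
  assume "f \<in> annihilated L" "g \<in> annihilated L"
  then show "f + g \<in> annihilated L"
    by (simp add: annihilated_def algebra_endomorphism_def distrib_left distrib_right coeff_sum_add)
next
  fix f g :: "'k free_algebra"
  assume f: "f \<in> annihilated L"
  have "coeff_sum L (u * \<phi> (g * f) * v) = 0" "coeff_sum L (u * \<phi> (f * g) * v) = 0"
    if \<phi>: "algebra_endomorphism \<phi>" for \<phi> u v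
  proof -
    have "coeff_sum L ((u * \<phi> g) * \<phi> f * v) = 0" "coeff_sum L (u * \<phi> f * (\<phi> g * v)) = 0"
      using f \<phi> by (auto simp: annihilated_def)
    then show "coeff_sum L (u * \<phi> (g * f) * v) = 0" "coeff_sum L (u * \<phi> (f * g) * v) = 0"
      using \<phi> by (simp_all add: algebra_endomorphism_def mult.assoc)
  qed
  then show "g * f \<in> annihilated L" "f * g \<in> annihilated L"
    by (simp_all add: annihilated_def)
next
  fix \<psi> :: "'k free_algebra \<Rightarrow> 'k free_algebra"
  assume "algebra_endomorphism \<psi>"
  then show "\<psi> ` annihilated L \<subseteq> annihilated L"
    using algebra_endomorphism_comp[of _ \<psi>] by (auto simp: annihilated_def)
qed

text \<open>
  \<open>partitions m w\<close> lists the ways to write \<open>w\<close> as a product of \<open>m\<close> nonempty words and a further word;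
  \<open>factorisations m w\<close> also allows a further word at the start.
\<close>

fun partitions :: "nat \<Rightarrow> nat list \<Rightarrow> (nat list list \<times> nat list) list" where
  "partitions 0 w = [([], w)]"
| "partitions (Suc m) [] = []"
| "partitions (Suc m) (x # w) =
    map (\<lambda>(ys, v). ([x] # ys, v)) (partitions m w) @
    map (\<lambda>(ys, v). ((x # hd ys) # tl ys, v)) (partitions (Suc m) w)"

fun factorisations :: "nat \<Rightarrow> nat list \<Rightarrow> (nat list \<times> nat list list \<times> nat list) list" where
  "factorisations m [] = map (\<lambda>(ys, v). ([], ys, v)) (partitions m [])"
| "factorisations m (x # w) =
    map (\<lambda>(ys, v). ([], ys, v)) (partitions m (x # w)) @
    map (\<lambda>(u, ys, v). (x # u, ys, v)) (factorisations m w)"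

lemma word_sum_X: "word_sum Q X = sum_list (map mon Q)"
  unfolding word_sum_def by (intro arg_cong[where f=sum_list] map_cong) (simp_all add: mon_eq_prod_X)

lemma partitions_complete:
  "w = concat ys @ v \<Longrightarrow> [] \<notin> set ys \<Longrightarrow> (ys, v) \<in> set (partitions (length ys) w)"
proof (induction "length ys" w arbitrary: ys rule: partitions.induct)
  case (2 m)
  then show ?case by (cases ys) auto
next
  case (3 m x w)
  obtain a y ys' where ys: "ys = (a # y) # ys'"
    using 3(3-5) by (cases ys; cases "hd ys") auto
  then have w: "a = x" "w = y @ concat ys' @ v" using 3(4) by auto
  show ?case
  proof (cases "y = []")
    case True
    then have "(ys', v) \<in> set (partitions (length ys') w)" using 3(1)[of ys'] 3(3,5) ys w by auto
    then show ?thesis using ys w True by (force simp: image_iff)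
  next
    case False
    then have "(y # ys', v) \<in> set (partitions (length (y # ys')) w)" using 3(2)[of "y # ys'"] 3(3,5) ys w by auto
    then show ?thesis using ys w by (force simp: image_iff)
  qed
qed auto

lemma factorisations_Nil: "(ys, v) \<in> set (partitions m w) \<Longrightarrow> ([], ys, v) \<in> set (factorisations m w)"
  by (cases w) auto

lemma factorisations_complete:
  "[] \<notin> set ys \<Longrightarrow> (u, ys, v) \<in> set (factorisations (length ys) (u @ concat ys @ v))"
proof (induction u)
  case Nil
  then have "(ys, v) \<in> set (partitions (length ys) (concat ys @ v))"
    by (intro partitions_complete) auto
  then show ?case using factorisations_Nil by simp
next
  case (Cons x u)
  then show ?case by (force simp: image_iff)
qed

definition is_permutation :: "nat \<Rightarrow> nat list \<Rightarrow> bool" where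
  "is_permutation m q \<longleftrightarrow> length q = m \<and> distinct q \<and> list_all (\<lambda>i. i \<in> set q) [1..<Suc m]"

text \<open>
  Whether the words \<open>u\<close>, \<open>ys\<close>, \<open>v\<close> give a product \<open>u q(ys) v\<close> in \<open>L\<close> for an even number of \<open>q\<close>
  in \<open>Q\<close>, and the requirement that this be so for all substitutions of nonempty words for the variables.
\<close>

definition even_multiplicity ::
  "nat list list \<Rightarrow> nat list list \<Rightarrow> nat list \<times> nat list list \<times> nat list \<Rightarrow> bool" where
  "even_multiplicity L Q = (\<lambda>(u, ys, v).
     even (length (filter (\<lambda>q. u @ concat (map (\<lambda>i. ys ! (i - 1)) q) @ v \<in> set L) Q)))"

definition always_even :: "nat list list \<Rightarrow> nat list list \<Rightarrow> nat \<Rightarrow> bool" where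
  "always_even L Q m \<longleftrightarrow> (\<forall>u Y v. (\<forall>i\<in>{1..m}. Y i \<noteq> []) \<longrightarrow>
     even (length (filter (\<lambda>q. u @ concat (map Y q) @ v \<in> set L) Q)))"

lemma set_is_permutation:
  assumes "is_permutation m q" shows "set q = {1..m}" and "distinct q"
proof -
  have q: "{1..m} \<subseteq> set q" "card (set q) = m" "distinct q"
    using assms by (auto simp: is_permutation_def list_all_iff distinct_card)
  have "card {1..m} = card (set q)" using q(2) by simp
  from card_subset_eq[OF finite_set q(1) this] show "set q = {1..m}" by (rule sym)
  show "distinct q" by (rule q(3))
qed

lemma even_multiplicity_map:
  assumes "list_all (is_permutation m) Q"
  shows "even_multiplicity L Q (u, map Y [1..<Suc m], v) \<longleftrightarrow>
    even (length (filter (\<lambda>q. u @ concat (map Y q) @ v \<in> set L) Q))"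
proof -
  have "filter (\<lambda>q. u @ concat (map (\<lambda>i. map Y [1..<Suc m] ! (i - 1)) q) @ v \<in> set L) Q =
      filter (\<lambda>q. u @ concat (map Y q) @ v \<in> set L) Q"
  proof (rule filter_cong)
    fix q assume "q \<in> set Q"
    then have "set q = {1..m}" using assms set_is_permutation by (auto simp: list_all_iff)
    then have "map (\<lambda>i. map Y [1..<Suc m] ! (i - 1)) q = map Y q"
      by (intro map_cong) (auto simp del: upt_Suc)
    then show "u @ concat (map (\<lambda>i. map Y [1..<Suc m] ! (i - 1)) q) @ v \<in> set L \<longleftrightarrow>
        u @ concat (map Y q) @ v \<in> set L" by (simp only:)
  qed simp
  then show ?thesis by (simp only: even_multiplicity_def prod.case)
qed

text \<open>
  If some product is in \<open>L\<close>, then the substituted words are a factorisation of a permutation of \<open>{1..d}\<close>, so that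
  there are only finitely many cases.
\<close>

lemma always_evenI:
  assumes L: "list_all (is_permutation d) L" and Q: "list_all (is_permutation m) Q"
    and check: "list_all (\<lambda>w. list_all (even_multiplicity L Q) (factorisations m w))
      (permutations_of_set_list [1..<Suc d])"
  shows "always_even L Q m"
  unfolding always_even_def
proof (intro allI impI)
  fix u v and Y :: "nat \<Rightarrow> nat list"
  assume Y: "\<forall>i\<in>{1..m}. Y i \<noteq> []"
  show "even (length (filter (\<lambda>q. u @ concat (map Y q) @ v \<in> set L) Q))"
  proof (cases "filter (\<lambda>q. u @ concat (map Y q) @ v \<in> set L) Q = []")
    case False
    then obtain q where q: "q \<in> set Q" "u @ concat (map Y q) @ v \<in> set L"
      by (auto simp: filter_empty_conv)
    define ys where "ys = map Y [1..<Suc m]"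
    have "set q = {1..m}" "distinct q" "set (u @ concat (map Y q) @ v) = {1..d}"
      "distinct (u @ concat (map Y q) @ v)"
      using q L Q set_is_permutation unfolding list_all_iff by blast+
    note q_L = this
    have "mset q = mset [1..<Suc m]"
      using q_L set_eq_iff_mset_eq_distinct[of q "[1..<Suc m]"]
      by (simp add: atLeastLessThanSuc_atLeastAtMost del: upt_Suc)
    then have "mset (map Y q) = mset ys" by (simp add: ys_def del: upt_Suc)
    then have "mset (concat (map Y q)) = mset (concat ys)"
      by (metis mset_concat mset_map sum_mset_sum_list)
    then have "mset (u @ concat ys @ v) = mset (u @ concat (map Y q) @ v)" by simp
    then have "set (u @ concat ys @ v) = {1..d} \<and> distinct (u @ concat ys @ v)"
      using q_L by (metis mset_eq_imp_distinct_iff mset_eq_setD)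
    then have "u @ concat ys @ v \<in> set (permutations_of_set_list [1..<Suc d])"
      using permutations_of_list[of "[1..<Suc d]"]
      by (auto simp: permutations_of_set_def distinct_remdups_id simp del: upt_Suc)
    moreover have "[] \<notin> set ys"
      using Y by (auto simp: ys_def image_iff simp del: upt_Suc) (metis atLeastAtMost_iff less_Suc_eq_le One_nat_def)
    then have "(u, ys, v) \<in> set (factorisations (length ys) (u @ concat ys @ v))"
      by (rule factorisations_complete)
    moreover have "length ys = m" by (simp add: ys_def)
    ultimately have "even_multiplicity L Q (u, ys, v)"
      using check by (auto simp: list_all_iff)
    then show ?thesis using even_multiplicity_map[OF Q] by (simp only: ys_def)
  qed simp
qed

text \<open>
  If \<open>Q\<close> consists of all permutations, then permuting the substituted words does not change the number of products
  in \<open>L\<close>. Hence it suffices to consider factorisations of the words in \<open>L\<close>.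
\<close>

lemma always_even_symmetricI:
  assumes Q: "list_all (is_permutation m) Q" "distinct Q" "length Q = fact m"
    and check: "list_all (\<lambda>w. list_all (even_multiplicity L Q) (factorisations m w)) L"
  shows "always_even L Q m"
  unfolding always_even_def
proof (intro allI impI)
  fix u v and Y :: "nat \<Rightarrow> nat list"
  assume Y: "\<forall>i\<in>{1..m}. Y i \<noteq> []"
  have perms: "set Q = permutations_of_set {1..m}"
  proof (rule card_subset_eq)
    show "set Q \<subseteq> permutations_of_set {1..m}"
      using Q(1) set_is_permutation by (fastforce simp: list_all_iff permutations_of_set_def)
    show "card (set Q) = card (permutations_of_set {1..m})"
      using Q(2,3) by (simp add: distinct_card)
  qed simp
  let ?P = "\<lambda>zs. u @ concat zs @ v \<in> set L"
  show "even (length (filter (\<lambda>q. ?P (map Y q)) Q))"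
  proof (cases "filter (\<lambda>q. ?P (map Y q)) Q = []")
    case False
    then obtain p where p: "p \<in> set Q" "?P (map Y p)"
      by (auto simp: filter_empty_conv)
    then have p_perm: "set p = {1..m}" "distinct p"
      unfolding perms by (simp_all add: permutations_of_set_def)
    then have "length p = m" using distinct_card[of p] by simp
    \<comment> \<open>Permute the substituted words so that they occur in the order in which \<open>p\<close> multiplies them.\<close>
    define Y' where "Y' i = Y (p ! (i - 1))" for i
    have Y'_upt: "map Y' [1..<Suc m] = map Y p"
      by (rule nth_equalityI) (simp_all add: Y'_def \<open>length p = m\<close> del: upt_Suc)
    define act where "act q = map (\<lambda>i. p ! (i - 1)) q" for q
    have p_inj: "inj_on (\<lambda>i. p ! (i - 1)) {1..m}"
      using p_perm(2) \<open>length p = m\<close> by (auto simp: inj_on_def nth_eq_iff_index_eq)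
    have p_img: "(\<lambda>i. p ! (i - 1)) ` {1..m} = {1..m}"
    proof (rule card_subset_eq)
      show "(\<lambda>i. p ! (i - 1)) ` {1..m} \<subseteq> {1..m}"
      proof
        fix j assume "j \<in> (\<lambda>i. p ! (i - 1)) ` {1..m}"
        then obtain i where "i \<in> {1..m}" "j = p ! (i - 1)" by blast
        then have "j \<in> set p" using nth_mem[of "i - 1" p] \<open>length p = m\<close> by auto
        then show "j \<in> {1..m}" by (simp only: p_perm)
      qed
    qed (use card_image[OF p_inj] in simp_all)
    have inj: "inj_on act (set Q)"
    proof (rule inj_onI)
      fix q r assume qr: "q \<in> set Q" "r \<in> set Q" "act q = act r"
      then have "set q = {1..m}" "set r = {1..m}"
        unfolding perms by (simp_all add: permutations_of_set_def)
      then have "inj_on (\<lambda>i. p ! (i - 1)) (set q \<union> set r)" using p_inj by simp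
      from inj_on_map_eq_map[OF this] show "q = r" using qr(3) unfolding act_def by blast
    qed
    have "act q \<in> set Q" if "q \<in> set Q" for q
    proof -
      have "set q = {1..m}" "distinct q"
        using that unfolding perms by (simp_all add: permutations_of_set_def)
      then have "set (act q) = {1..m}" "distinct (act q)"
        using p_img p_inj by (simp_all only: act_def set_map distinct_map)
      then show ?thesis unfolding perms by (rule permutations_of_setI)
    qed
    then have "act ` set Q \<subseteq> set Q" by blast
    then have "act ` set Q = set Q"
      using card_image[OF inj] by (simp add: card_subset_eq)
    then have "mset (map act Q) = mset Q"
      using Q(2) inj set_eq_iff_mset_eq_distinct[of "map act Q" Q] by (simp add: distinct_map)
    then have "length (filter (\<lambda>q. ?P (map Y q)) (map act Q)) = length (filter (\<lambda>q. ?P (map Y q)) Q)"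
      by (metis mset_filter size_mset)
    moreover have "filter (\<lambda>q. ?P (map Y q)) (map act Q) = map act (filter (\<lambda>q. ?P (map Y' q)) Q)"
      by (simp add: filter_map comp_def act_def Y'_def[abs_def])
    ultimately have count: "length (filter (\<lambda>q. ?P (map Y q)) Q) = length (filter (\<lambda>q. ?P (map Y' q)) Q)"
      by simp
    have "[] \<notin> set (map Y p)" using Y p_perm(1) by (metis imageE list.set_map)
    then have "(u, map Y p, v) \<in> set (factorisations (length (map Y p)) (u @ concat (map Y p) @ v))"
      by (rule factorisations_complete)
    then have "even_multiplicity L Q (u, map Y p, v)"
      using check p(2) \<open>length p = m\<close> by (auto simp: list_all_iff)
    then have "even (length (filter (\<lambda>q. ?P (map Y' q)) Q))"
      unfolding Y'_upt[symmetric] even_multiplicity_map[OF Q(1)] .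
    then show ?thesis by (simp only: count)
  qed simp
qed

lemma multilinear_word_sum:
  assumes "list_all (is_permutation m) Q" shows "multilinear m (word_sum Q X :: 'k::field free_algebra)"
proof -
  have "Poly_Mapping.keys (sum_list (map mon R) :: 'k free_algebra) \<subseteq> set R" for R
  proof (induction R)
    case (Cons r R)
    moreover have "Poly_Mapping.keys (mon r :: 'k free_algebra) \<subseteq> {r}" by (simp add: mon_def)
    ultimately show ?case using keys_add[of "mon r :: 'k free_algebra" "sum_list (map mon R)"] by auto
  qed simp
  from this[of Q] have "Poly_Mapping.keys (word_sum Q X :: 'k free_algebra) \<subseteq> set Q"
    by (simp add: word_sum_X)
  also have "set Q \<subseteq> permutations_of_set {1..m}"
    using assms set_is_permutation by (fastforce simp: list_all_iff permutations_of_set_def)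
  finally show ?thesis unfolding multilinear_def by (intro exI[of _ "{1..m}"]) simp
qed

context
  assumes char: "CHAR('k::field) = 2"
begin

text \<open>
  By multilinearity it suffices to substitute monomials. Substituting an empty word gives 0 by the second
  assumption, and substituting nonempty words gives 0 by the first.
\<close>

lemma word_sum_in_annihilated:
  assumes perms: "list_all (is_permutation m) Q" and even: "always_even L Q m"
    and unit: "\<And>y i. i \<in> {1..m} \<Longrightarrow> y i = 1 \<Longrightarrow> word_sum Q y = (0 :: 'k free_algebra)"
  shows "word_sum Q X \<in> (annihilated L :: 'k free_algebra set)"
proof -
  have Q: "set q = {1..m}" "distinct q" if "q \<in> set Q" for q
    using that perms set_is_permutation by (auto simp: list_all_iff)
  have words: "coeff_sum L (mon u * word_sum Q (\<lambda>i. mon (Y i)) * mon v) = (0 :: 'k)" for u v Y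
  proof (cases "\<exists>i\<in>{1..m}. Y i = []")
    case True
    then obtain i where i: "i \<in> {1..m}" "Y i = []" by blast
    then have "word_sum Q (\<lambda>i. mon (Y i) :: 'k free_algebra) = 0"
      using unit[of i "\<lambda>i. mon (Y i)"] by (simp add: mon_Nil)
    then show ?thesis by (simp add: coeff_sum_0)
  next
    case False
    have prod_mon: "prod_list (map (\<lambda>i. mon (Y i)) q) = (mon (concat (map Y q)) :: 'k free_algebra)" for q
      by (induction q) (simp_all add: mon_Nil mon_append)
    have "mon u * word_sum Q (\<lambda>i. mon (Y i)) * mon v =
        (sum_list (map mon (map (\<lambda>q. u @ concat (map Y q) @ v) Q)) :: 'k free_algebra)"
      by (simp add: word_sum_def prod_mon comp_def mon_append mult.assoc
          flip: sum_list_const_mult sum_list_mult_const)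
    then have count: "coeff_sum L (mon u * word_sum Q (\<lambda>i. mon (Y i)) * mon v) =
        (of_nat (length (filter (\<lambda>q. u @ concat (map Y q) @ v \<in> set L) Q)) :: 'k)"
      by (simp only: coeff_sum_sum_list_mon) (simp add: filter_map comp_def)
    have "even (length (filter (\<lambda>q. u @ concat (map Y q) @ v \<in> set L) Q))"
      using even False unfolding always_even_def by blast
    then show ?thesis
      unfolding count using char by (simp add: of_nat_eq_0_iff_char_dvd)
  qed
  have update: "prod_list (map (y(i := f)) q) = prod_list (map y (takeWhile ((\<noteq>) i) q)) * f *
      (prod_list (map y (tl (dropWhile ((\<noteq>) i) q))) :: 'k free_algebra)"
    if q: "q \<in> set Q" and i: "i \<in> {1..m}" for q i y f
  proof -
    obtain a b where ab: "q = a @ i # b" "i \<notin> set a" using Q(1)[OF q] i split_list_first by metis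
    then have "i \<notin> set b" using Q(2)[OF q] by auto
    moreover have "takeWhile ((\<noteq>) i) q = a" "dropWhile ((\<noteq>) i) q = i # b"
      using ab by (auto simp: takeWhile_append dropWhile_append)
    moreover have "prod_list (map (y(i := f)) a) = prod_list (map y a)"
      "prod_list (map (y(i := f)) b) = prod_list (map y b)"
      using ab(2) \<open>i \<notin> set b\<close> by (auto intro!: arg_cong[where f=prod_list] map_cong)
    ultimately show ?thesis by (simp add: ab(1) mult.assoc)
  qed
  have word_sum_add: "word_sum Q (y(i := f + g)) = word_sum Q (y(i := f)) + (word_sum Q (y(i := g)) :: 'k free_algebra)"
    if "i \<in> {1..m}" for i y f g
    unfolding word_sum_def sum_list_addf[symmetric]
    by (intro arg_cong[where f=sum_list] map_cong refl)
      (simp only: update that distrib_left distrib_right)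
  have word_sum_scal: "word_sum Q (y(i := scal c * f)) = scal c * (word_sum Q (y(i := f)) :: 'k free_algebra)"
    if "i \<in> {1..m}" for i y c f
    unfolding word_sum_def sum_list_const_mult[symmetric]
  proof (intro arg_cong[where f=sum_list] map_cong refl)
    fix q assume "q \<in> set Q"
    have "a * (scal c * f) * b = scal c * (a * f * b)" for a b :: "'k free_algebra"
      by (simp add: mult_scal_left mult.assoc)
    then show "prod_list (map (y(i := scal c * f)) q) = scal c * prod_list (map (y(i := f)) q)"
      by (simp only: update[OF \<open>q \<in> set Q\<close> that])
  qed
  have variables: "coeff_sum L (mon u * word_sum Q y * mon v) = (0 :: 'k)"
    if "k \<le> m" "\<forall>i\<in>{Suc k..m}. y i \<in> range mon" for k y u v
    using that
  proof (induction k arbitrary: y)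
    case 0
    have "\<forall>i\<in>{1..m}. \<exists>w. y i = mon w" using 0(2) by auto
    from bchoice[OF this] obtain Y where Y: "y i = mon (Y i)" if "i \<in> {1..m}" for i by blast
    have "word_sum Q y = word_sum Q (\<lambda>i. mon (Y i))"
      unfolding word_sum_def
      using Q(1) Y by (intro arg_cong[where f=sum_list] map_cong arg_cong[where f=prod_list]) auto
    then show ?case using words by simp
  next
    case (Suc k)
    let ?i = "Suc k"
    have i: "?i \<in> {1..m}" using Suc.prems(1) by simp
    have "coeff_sum L (mon u * word_sum Q (y(?i := f)) * mon v) = 0" for f
    proof (induction f rule: free_algebra_induct)
      case (monomial c w)
      have "coeff_sum L (mon u * word_sum Q (y(?i := mon w)) * mon v) = 0"
        using Suc.prems by (intro Suc.IH) auto
      moreover have "mon u * word_sum Q (y(?i := scal c * mon w)) * mon v =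
          scal c * (mon u * word_sum Q (y(?i := mon w)) * mon v)"
        unfolding word_sum_scal[OF i] mult_scal_left by (simp add: mult.assoc)
      ultimately show ?case by (simp only: coeff_sum_scal mult_zero_right)
    next
      case (add f g)
      then show ?case
        by (simp only: word_sum_add[OF i] distrib_left distrib_right coeff_sum_add add_0_left)
    qed
    from this[of "y ?i"] show ?case by simp
  qed
  have zero: "coeff_sum L (g * word_sum Q y * h) = (0 :: 'k)" for g h y
  proof (induction g rule: free_algebra_induct)
    case (monomial c u)
    show ?case
    proof (induction h rule: free_algebra_induct)
      case (monomial d v)
      have "coeff_sum L (mon u * word_sum Q y * mon v) = 0"
        using variables[of m] by simp
      moreover have "scal c * mon u * word_sum Q y * (scal d * mon v) =
          scal c * (scal d * (mon u * word_sum Q y * mon v))"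
        using mult_scal_left[of "mon u * word_sum Q y" d "mon v"] by (simp add: mult.assoc)
      ultimately show ?case by (simp add: coeff_sum_scal)
    qed (simp add: distrib_left coeff_sum_add)
  qed (simp add: distrib_right coeff_sum_add)
  have hom: "\<phi> (word_sum Q X) = word_sum Q (\<lambda>i. \<phi> (X i))"
    if \<phi>: "algebra_endomorphism \<phi>" for \<phi> :: "'k free_algebra \<Rightarrow> 'k free_algebra"
  proof -
    have "\<phi> 0 = 0" using \<phi> unfolding algebra_endomorphism_def by (metis add_cancel_right_left)
    have "\<phi> (sum_list (map mon R)) = sum_list (map (\<lambda>q. prod_list (map (\<lambda>i. \<phi> (X i)) q)) R)" for R
      using \<phi> \<open>\<phi> 0 = 0\<close>
      by (induction R) (simp_all add: algebra_endomorphism_mon[OF \<phi>], simp add: algebra_endomorphism_def algebra_endomorphism_mon[OF \<phi>])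
    then show ?thesis unfolding word_sum_X by (simp add: word_sum_def)
  qed
  have "coeff_sum L (g * \<phi> (word_sum Q X) * h) = (0 :: 'k)" if "algebra_endomorphism \<phi>" for \<phi> g h
    unfolding hom[OF that] by (rule zero)
  then show ?thesis unfolding annihilated_def by blast
qed

lemma not_consequence:
  assumes "F \<subseteq> (annihilated L :: 'k free_algebra set)"
    and "odd (length (filter (\<lambda>q. q \<in> set L) Q))"
  shows "\<not> consequence (word_sum Q X) F"
proof
  assume "consequence (word_sum Q X) F"
  then have "word_sum Q X \<in> (annihilated L :: 'k free_algebra set)"
    unfolding consequence_def using hull_minimal[of F "annihilated L" T_ideal] assms(1) T_ideal_annihilated by blast
  moreover have "algebra_endomorphism (\<lambda>f :: 'k free_algebra. f)"
    by (simp add: algebra_endomorphism_def)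
  ultimately have "coeff_sum L (1 * word_sum Q X * 1 :: 'k free_algebra) = 0"
    unfolding annihilated_def by blast
  moreover have "coeff_sum L (word_sum Q X :: 'k free_algebra) = of_nat (length (filter (\<lambda>q. q \<in> set L) Q))"
    using coeff_sum_sum_list_mon[of L Q] by (simp add: word_sum_X)
  ultimately show False
    using assms(2) char by (simp add: of_nat_eq_0_iff_char_dvd)
qed

end

text \<open>
  Lists of words that separate each of the three identities from the consequences of the other two, found by
  linear algebra over the field with two elements. The first one works because the other two identities have
  degree 5.
\<close>

definition witness_st4 :: "nat list list" where
  "witness_st4 = [[1,2,3,4]]"

definition witness_S5 :: "nat list list" where
  "witness_S5 = [[1,2,3,4,5], [1,2,3,5,4], [1,3,2,4,5], [1,3,2,5,4],
    [5,2,4,3,1], [5,3,4,2,1], [4,2,5,3,1], [4,3,5,2,1]]"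

definition witness_T5 :: "nat list list" where
  "witness_T5 = [[1,2,3,4,5], [1,3,5,4,2], [3,2,5,4,1], [3,4,1,2,5], [4,2,3,5,1], [4,5,1,3,2]]"

lemma is_permutation_words:
  "list_all (is_permutation 4) st4_words" "list_all (is_permutation 5) S5_words"
  "list_all (is_permutation 5) T5_words" "list_all (is_permutation 4) witness_st4"
  "list_all (is_permutation 5) witness_S5" "list_all (is_permutation 5) witness_T5"
  by code_simp+

lemma always_even_witness_st4:
  "always_even witness_st4 S5_words 5" "always_even witness_st4 T5_words 5"
  by (rule always_evenI[OF is_permutation_words(4) is_permutation_words(2)], code_simp)
    (rule always_evenI[OF is_permutation_words(4) is_permutation_words(3)], code_simp)

lemma always_even_st4_words:
  "always_even witness_S5 st4_words 4" "always_even witness_T5 st4_words 4"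
  by (rule always_even_symmetricI[OF is_permutation_words(1)], code_simp, simp add: st4_words_def fact_numeral, code_simp)+

lemma always_even_witness_S5: "always_even witness_S5 T5_words 5"
  by (rule always_evenI[OF is_permutation_words(5) is_permutation_words(3)]) code_simp

lemma always_even_witness_T5: "always_even witness_T5 S5_words 5"
  by (rule always_evenI[OF is_permutation_words(6) is_permutation_words(2)]) code_simp

lemma odd_on_witnesses:
  "odd (length (filter (\<lambda>q. q \<in> set witness_st4) st4_words))"
  "odd (length (filter (\<lambda>q. q \<in> set witness_S5) S5_words))"
  "odd (length (filter (\<lambda>q. q \<in> set witness_T5) T5_words))"
  by code_simp+

lemma commutator_1 [simp]: "commutator 1 x = (0 :: 'b::ring_1)" "commutator x 1 = (0 :: 'b)"
  and commutator_0 [simp]: "commutator 0 x = (0 :: 'b)" "commutator x 0 = (0 :: 'b)"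
  by (simp_all add: commutator_def)

text \<open>
  The three identities are built from commutators, so they vanish when a variable is 1.
\<close>

lemma word_sum_unit:
  fixes y :: "nat \<Rightarrow> 'b::ring_1"
  assumes double: "\<And>x :: 'b. x + x = 0" and y: "y i = 1"
  shows "i \<in> {1..4} \<Longrightarrow> word_sum st4_words y = 0"
    and "i \<in> {1..5} \<Longrightarrow> word_sum S5_words y = 0"
    and "i \<in> {1..5} \<Longrightarrow> word_sum T5_words y = 0"
proof -
  have comm: "commutator a b = commutator b (a :: 'b)" for a b
    by (simp add: commutator_def minus_char_2[OF double] add.commute)
  have cases4: "i = 1 \<or> i = 2 \<or> i = 3 \<or> i = 4" if "i \<in> {1..4}" using that by auto
  have cases5: "i = 1 \<or> i = 2 \<or> i = 3 \<or> i = 4 \<or> i = 5" if "i \<in> {1..5}" using that by auto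
  show "word_sum st4_words y = 0" if "i \<in> {1..4}"
    using cases4[OF that] y unfolding word_sum_st4[OF double] by (elim disjE) simp_all
  show "word_sum S5_words y = 0" if "i \<in> {1..5}"
    using cases5[OF that] y unfolding word_sum_S5[OF double] by (elim disjE) simp_all
  show "word_sum T5_words y = 0" if "i \<in> {1..5}"
    using cases5[OF that] y comm[of "y 4" "y 5"] comm[of "y 3" "y 5"] comm[of "y 3" "y 4"]
    unfolding word_sum_T5[OF double] by (elim disjE) (simp_all add: double comm[of _ "y 4"])
qed

lemma multilinear_identities_upto_7_follow_fromD:
  "multilinear_identities_upto_7_follow_from F \<Longrightarrow> n \<le> 7 \<Longrightarrow> multilinear n f \<Longrightarrow> identity_of_M2 f \<Longrightarrow>
    consequence f F"
  by (simp add: multilinear_identities_upto_7_follow_from_def)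

theorem theorem1p2:
  assumes "infinite (UNIV :: 'k::field set)"
    and "CHAR('k) = 2"
  shows "identity_of_M2 (st4 :: 'k free_algebra) \<and>
    identity_of_M2 (S5 :: 'k free_algebra) \<and>
    identity_of_M2 (T5 :: 'k free_algebra) \<and>
    multilinear_identities_upto_7_follow_from {st4, S5, T5 :: 'k free_algebra} \<and>
    \<not> multilinear_identities_upto_7_follow_from {S5, T5 :: 'k free_algebra} \<and>
    \<not> multilinear_identities_upto_7_follow_from {st4, T5 :: 'k free_algebra} \<and>
    \<not> multilinear_identities_upto_7_follow_from {st4, S5 :: 'k free_algebra}"
proof -
  note char = assms(2)
  note eqs = st4_eq_word_sum[OF char] S5_eq_word_sum[OF char] T5_eq_word_sum[OF char]
  note ids = identity_of_M2_st4[OF char] identity_of_M2_S5[OF char] identity_of_M2_T5[OF char]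
  note unit = word_sum_unit[OF free_algebra_double[OF char]]
  note annihilated =
    word_sum_in_annihilated[OF char is_permutation_words(2) always_even_witness_st4(1)]
    word_sum_in_annihilated[OF char is_permutation_words(3) always_even_witness_st4(2)]
    word_sum_in_annihilated[OF char is_permutation_words(1) always_even_st4_words(1)]
    word_sum_in_annihilated[OF char is_permutation_words(3) always_even_witness_S5]
    word_sum_in_annihilated[OF char is_permutation_words(1) always_even_st4_words(2)]
    word_sum_in_annihilated[OF char is_permutation_words(2) always_even_witness_T5]
  have "multilinear_identities_upto_7_follow_from {st4, S5, T5 :: 'k free_algebra}"
    unfolding multilinear_identities_upto_7_follow_from_def
    using multilinear_identity_consequence[OF char] by blast
  moreover have "\<not> multilinear_identities_upto_7_follow_from {S5, T5 :: 'k free_algebra}"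
  proof -
    have "{S5, T5 :: 'k free_algebra} \<subseteq> annihilated witness_st4"
      unfolding eqs using annihilated(1,2) unit(2,3) by blast
    then have "\<not> consequence st4 {S5, T5 :: 'k free_algebra}"
      unfolding eqs(1) by (rule not_consequence[OF char _ odd_on_witnesses(1)])
    moreover have "multilinear 4 (st4 :: 'k free_algebra)"
      unfolding eqs by (rule multilinear_word_sum[OF is_permutation_words(1)])
    ultimately show ?thesis
      using ids(1) multilinear_identities_upto_7_follow_fromD[of _ 4] by fastforce
  qed
  moreover have "\<not> multilinear_identities_upto_7_follow_from {st4, T5 :: 'k free_algebra}"
  proof -
    have "{st4, T5 :: 'k free_algebra} \<subseteq> annihilated witness_S5"
      unfolding eqs using annihilated(3,4) unit(1,3) by blast
    then have "\<not> consequence S5 {st4, T5 :: 'k free_algebra}"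
      unfolding eqs(2) by (rule not_consequence[OF char _ odd_on_witnesses(2)])
    moreover have "multilinear 5 (S5 :: 'k free_algebra)"
      unfolding eqs by (rule multilinear_word_sum[OF is_permutation_words(2)])
    ultimately show ?thesis
      using ids(2) multilinear_identities_upto_7_follow_fromD[of _ 5] by fastforce
  qed
  moreover have "\<not> multilinear_identities_upto_7_follow_from {st4, S5 :: 'k free_algebra}"
  proof -
    have "{st4, S5 :: 'k free_algebra} \<subseteq> annihilated witness_T5"
      unfolding eqs using annihilated(5,6) unit(1,2) by blast
    then have "\<not> consequence T5 {st4, S5 :: 'k free_algebra}"
      unfolding eqs(3) by (rule not_consequence[OF char _ odd_on_witnesses(3)])
    moreover have "multilinear 5 (T5 :: 'k free_algebra)"
      unfolding eqs by (rule multilinear_word_sum[OF is_permutation_words(3)])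
    ultimately show ?thesis
      using ids(3) multilinear_identities_upto_7_follow_fromD[of _ 5] by fastforce
  qed
  ultimately show ?thesis using ids by blast
qed

end
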